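(* Let $\phi:D\longrightarrow\tilde D\otimes D$ be defined for all $(t,s)\in D$ by $$\phi(t,s)=\sum_{s'\subseteq s}(t,s')\otimes(t/s',s/s').$$ Then $D$ admits a comodule structure on $\tilde D$ given by $\phi$; that is, $\phi$ is a coaction of the coalgebra $(\tilde D,\Gamma,\varepsilon)$ on $D$, where $\Gamma(t,s)=\sum_{s'\subseteq s}(t,s')\otimes(t/s',s/s')$, and in particular $(\Gamma\otimes \mathrm{id})\circ\phi=(\mathrm{id}\otimes\phi)\circ\phi$.
   Context: Work over a fixed base field. A rooted tree is a finite connected simply connected oriented graph in which every vertex has exactly one incoming edge, except a distinguished vertex (the root) which has none; a rooted forest is a finite (possibly empty) disjoint union of rooted trees; trees and forests are taken up to isomorphism. The product of forests is disjoint union and $\mathbf 1$ denotes the empty forest. Admissible cuts: an admissible cut $c$ of a rooted tree $t$ is a (possibly empty) set of edges such that every path from the root to a leaf contains at most one edge of $c$; in addition one allows the total cut. The pruning $P^c(t)$ is the subforest of $t$ lying above the cut. For the empty cut $P^c(t)=\mathbf 1$; for the total cut $P^c(t)=t$. A subforest $s$ of a tree (or forest) $t$ is a (possibly empty) collection of pairwise vertex-disjoint subtrees of $t$; it is a covering subforest of $t$ if every vertex of $t$ belongs to one of these subtrees (single-vertex subtrees are allowed). In the sums defining $\phi$ and $\Gamma$, $s'\subseteq s$ runs over the covering subforests of $s$. If $s'$ is a subforest of $t$, $t/s'$ is obtained from $t$ by contracting each connected component of $s'$ onto a vertex; similarly $s/s'$, which is regarded as a subforest of $t/s'$. $V$ (resp.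 $\tilde V$) is the vector space spanned by couples $(t,s)$ with $t$ a rooted tree and $s=P^{c_0}(t)$ for some admissible cut $c_0$ of $t$ (resp. $s$ any subforest of $t$); the couple $(\mathbf 1,\mathbf 1)$ is allowed and identified with the unit; $s$ is remembered as a subforest of $t$ and couples are taken up to isomorphism of couples. $D=S(V)$ and $\tilde D=S(\tilde V)$, with product $(t,s)(t',s')=(tt',ss')$; $\Gamma$ and $\phi$ are extended multiplicatively. The map $\phi$ takes values in $\tilde D\otimes D$ because if $s=P^{c_0}(t)$ then $s/s'$ is the pruning of $t/s'$ for the admissible cut deduced from $c_0$. The counit of $\tilde D$ is the multiplicative map with $\varepsilon(t,s)=1$ if $s$ has no edge and $\varepsilon(t,s)=0$ otherwise. *)

theory Defs
  imports
    "Graph_Theory.Graph_Theory"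
    "HOL-Library.Poly_Mapping"
    "HOL-Library.Product_Plus"
    "HOL-Library.Multiset"
begin

section \<open>Rooted trees and subforests\<close>

text \<open>
  Trees and forests are finite directed graphs whose arcs are pairs of vertices
  (\<^typ>\<open>'a pair_pre_digraph\<close>); arcs are directed away from the root. Oriented means that there
  are neither loops nor antiparallel arcs; simply connected means that the underlying undirected
  graph has no cycle. In the symmetrisation every arc gives a closed walk of length 2, so that the
  genuine cycles are those of length at least 3.
\<close>

definition is_root :: "'a pair_pre_digraph \<Rightarrow> 'a \<Rightarrow> bool" where
  "is_root t r \<longleftrightarrow> r \<in> pverts t \<and> in_degree (with_proj t) r = 0"

definition is_leaf :: "'a pair_pre_digraph \<Rightarrow> 'a \<Rightarrow> bool" where
  "is_leaf t v \<longleftrightarrow> v \<in> pverts t \<and> out_degree (with_proj t) v = 0"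

definition rooted_tree :: "'a pair_pre_digraph \<Rightarrow> bool" where
  "rooted_tree t \<longleftrightarrow>
     pair_digraph t \<and> antisym (parcs t) \<and>
     connected (with_proj t) \<and>
     (\<nexists>p. pre_digraph.cycle (with_proj (mk_symmetric (with_proj t))) p \<and> 3 \<le> length p) \<and>
     (\<exists>r. is_root t r \<and> (\<forall>v \<in> pverts t - {r}. in_degree (with_proj t) v = 1))"

text \<open>
  Simple connectedness and orientedness follow from the other conditions.
\<close>

lemma rooted_treeI:
  assumes fin: "pair_fin_digraph t" and con: "connected (with_proj t)"
    and root: "is_root t r"
    and indeg: "\<And>v. v \<in> pverts t \<Longrightarrow> v \<noteq> r \<Longrightarrow> in_degree (with_proj t) v = 1"
  shows "rooted_tree t"
proof -
  interpret t: pair_fin_digraph t by (rule fin)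
  let ?S = "mk_symmetric (with_proj t)"
  have S: "parcs ?S = parcs t \<union> (parcs t)\<inverse>" "pverts ?S = pverts t"
    by (auto simp: mk_symmetric_def)
  have in_arcs: "in_arcs (with_proj t) v = {e \<in> parcs t. snd e = v}" for v
    by (simp add: in_arcs_def)
  have rV: "r \<in> pverts t" and noin: "(u, r) \<notin> parcs t" for u
  proof -
    have "in_arcs (with_proj t) r = {}"
      using root t.finite_arcs unfolding is_root_def in_degree_def in_arcs by simp
    then show "(u, r) \<notin> parcs t" by (auto simp: in_arcs)
  qed (use root in \<open>simp add: is_root_def\<close>)
  have wf: "u \<in> pverts t" "v \<in> pverts t" if "(u, v) \<in> parcs t" for u v
    using t.arc_fst_in_verts[OF that] t.arc_snd_in_verts[OF that] by auto
  have uniq: "u = u'" if "(u, v) \<in> parcs t" "(u', v) \<in> parcs t" for u u' v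
  proof -
    have "v \<noteq> r" using noin that by auto
    then have "card {e \<in> parcs t. snd e = v} = 1"
      using indeg wf(2)[OF that(1)] by (simp add: in_degree_def in_arcs)
    then obtain e where "{e \<in> parcs t. snd e = v} = {e}" by (auto simp: card_1_singleton_iff)
    moreover have "(u, v) \<in> {e \<in> parcs t. snd e = v}" "(u', v) \<in> {e \<in> parcs t. snd e = v}"
      using that by auto
    ultimately show ?thesis by (metis prod.inject singletonD)
  qed
  have parent: "\<exists>u. (u, v) \<in> parcs t" if "v \<in> pverts t" "v \<noteq> r" for v
  proof -
    have "card {e \<in> parcs t. snd e = v} = 1"
      using indeg that by (simp add: in_degree_def in_arcs)
    then have "{e \<in> parcs t. snd e = v} \<noteq> {}" by force
    then show ?thesis by auto
  qed
  have reach: "(r, v) \<in> (parcs t)\<^sup>*" if v: "v \<in> pverts t" for v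
  proof -
    have "r \<rightarrow>\<^sup>*\<^bsub>with_proj ?S\<^esub> v"
      using con v rV S by (auto simp: connected_def strongly_connected_def)
    then have "(r, v) \<in> rtrancl_on (pverts t) (parcs t \<union> (parcs t)\<inverse>)"
      by (simp add: reachable_def S)
    then have "(r, v) \<in> (parcs t \<union> (parcs t)\<inverse>)\<^sup>*"
      by (simp only: rtrancl_on_rtranclI)
    then show ?thesis
    proof (induction rule: rtrancl_induct)
      case (step y z)
      show ?case
      proof (cases "(y, z) \<in> parcs t")
        case False
        then have zy: "(z, y) \<in> parcs t" using step by auto
        then have "y \<noteq> r" using noin by auto
        then obtain w where "(r, w) \<in> (parcs t)\<^sup>*" "(w, y) \<in> parcs t"
          using step.IH by (metis rtranclE)
        then show ?thesis using uniq zy by metis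
      qed (use step in auto)
    qed simp
  qed
  define d where "d v = (LEAST n. (r, v) \<in> parcs t ^^ n)" for v
  have dw: "(r, v) \<in> parcs t ^^ d v" if "v \<in> pverts t" for v
    using reach[OF that] unfolding d_def rtrancl_power by (rule LeastI_ex)
  have depth: "d u < d v" if uv: "(u, v) \<in> parcs t" for u v
  proof -
    have "(r, v) \<in> parcs t ^^ d v" using dw wf(2) uv by auto
    moreover have "v \<noteq> r" using noin uv by auto
    ultimately obtain n where n: "d v = Suc n" by (cases "d v") auto
    then obtain w where "(r, w) \<in> parcs t ^^ n" "(w, v) \<in> parcs t"
      using \<open>(r, v) \<in> parcs t ^^ d v\<close> by auto
    then have "(r, u) \<in> parcs t ^^ n" using uniq uv by metis
    then have "d u \<le> n" unfolding d_def by (rule Least_le)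
    then show ?thesis using n by simp
  qed
  have "pair_digraph t"
    by unfold_locales (use depth in fastforce)
  moreover have "antisym (parcs t)"
    using depth by (meson antisymI less_asym)
  moreover have "\<nexists>p. pre_digraph.cycle (with_proj ?S) p \<and> 3 \<le> length p"
  proof
    assume "\<exists>p. pre_digraph.cycle (with_proj ?S) p \<and> 3 \<le> length p"
    then obtain p u where aw: "pre_digraph.awalk (with_proj ?S) u p u"
      and dist: "distinct (tl (pawalk_verts u p))" and len: "3 \<le> length p"
      by (auto simp: pre_digraph.cycle_def awalk_verts_with_proj_eq)
    have arcs: "set p \<subseteq> parcs t \<union> (parcs t)\<inverse>" and cas: "pcas u p u"
      using aw by (auto simp: pre_digraph.awalk_def S cas_with_proj_eq)
    have verts: "pawalk_verts a q = a # map snd q" if "pcas a q b" for a q b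
      using that by (induction q arbitrary: a) auto
    have dist': "distinct (map snd p)" using dist verts[OF cas] by simp
    have chain: "\<forall>i. Suc i < length q \<longrightarrow> fst (q ! Suc i) = snd (q ! i)"
        "q \<noteq> [] \<Longrightarrow> fst (q ! 0) = a \<and> snd (last q) = b" if "pcas a q b" for a q b
      using that
    proof (induction q arbitrary: a)
      case (Cons e q)
      {
        case 1
        with Cons.IH(1)[of "snd e"] Cons.IH(2)[of "snd e"] show ?case
          by (cases q) (auto simp: nth_Cons' gr0_conv_Suc split: if_splits)
      next
        case 2
        with Cons.IH(2)[of "snd e"] show ?case by (cases q) auto
      }
    qed auto
    let ?n = "length p"
    have cyc: "fst (p ! (Suc i mod ?n)) = snd (p ! i)" if "i < ?n" for i
    proof (cases "Suc i = ?n")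
      case True
      have "p \<noteq> []" using len by auto
      moreover from this have "p ! i = last p"
        using True by (simp add: last_conv_nth flip: True)
      ultimately show ?thesis using True chain(2)[OF cas] by simp
    qed (use that chain(1)[OF cas] in simp)
    have fin: "finite ((\<lambda>i. d (snd (p ! i))) ` {..<?n})" "(\<lambda>i. d (snd (p ! i))) ` {..<?n} \<noteq> {}"
      using len by (auto simp: lessThan_empty_iff)
    obtain i where i: "i < ?n"
      and Max: "Max ((\<lambda>i. d (snd (p ! i))) ` {..<?n}) = d (snd (p ! i))"
      using Max_in[OF fin] by auto
    have max: "d (snd (p ! j)) \<le> d (snd (p ! i))" if "j < ?n" for j
      unfolding Max[symmetric] using fin(1) that by (intro Max_ge) auto
    define j where "j = Suc i mod ?n"
    define k where "k = (i + ?n - 1) mod ?n"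
    have jk: "j < ?n" "k < ?n" unfolding j_def k_def by (rule mod_less_divisor, use len in linarith)+
    have ki: "Suc k mod ?n = i" using i len by (cases i) (auto simp: k_def mod_Suc_eq)
    have pair: "(fst e, snd e) \<in> parcs t \<union> (parcs t)\<inverse>" if "e \<in> set p" for e
      using arcs that by auto
    have "(snd (p ! k), snd (p ! i)) \<in> parcs t \<union> (parcs t)\<inverse>"
      using pair[OF nth_mem[OF i]] cyc[OF jk(2), unfolded ki] by simp
    moreover have "(snd (p ! i), snd (p ! k)) \<notin> parcs t"
      using depth max[OF jk(2)] by (meson not_le)
    ultimately have ki_arc: "(snd (p ! k), snd (p ! i)) \<in> parcs t" by simp
    have "(snd (p ! i), snd (p ! j)) \<in> parcs t \<union> (parcs t)\<inverse>"
      using pair[OF nth_mem[OF jk(1)]] cyc[OF i, folded j_def] by simp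
    moreover have "(snd (p ! i), snd (p ! j)) \<notin> parcs t"
      using depth max[OF jk(1)] by (meson not_le)
    ultimately have "(snd (p ! j), snd (p ! i)) \<in> parcs t" by simp
    with ki_arc have "snd (p ! k) = snd (p ! j)" by (rule uniq)
    then have "k = j" using dist' jk by (metis length_map nth_eq_iff_index_eq nth_map)
    then show False
      using i len by (cases i; cases "Suc i = ?n") (auto simp: j_def k_def)
  qed
  ultimately show ?thesis
    unfolding rooted_tree_def using con root indeg by blast
qed

lemma rooted_tree_singleton: "rooted_tree \<lparr> pverts = {v}, parcs = {} \<rparr>"
proof (rule rooted_treeI)
  show "pair_fin_digraph \<lparr> pverts = {v}, parcs = {} \<rparr>" by unfold_locales auto
  show "connected (with_proj \<lparr> pverts = {v}, parcs = {} \<rparr>)"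
    by (auto simp: connected_def strongly_connected_def mk_symmetric_def reachable_def)
  show "is_root \<lparr> pverts = {v}, parcs = {} \<rparr> v"
    by (auto simp: is_root_def in_degree_def in_arcs_def)
qed auto

definition subtree :: "'a pair_pre_digraph \<Rightarrow> 'a pair_pre_digraph \<Rightarrow> bool" where
  "subtree u t \<longleftrightarrow> rooted_tree u \<and> subgraph (with_proj u) (with_proj t)"

text \<open>
  A subforest is stored as the union of the graphs in the collection; the collection is recovered
  as the set of connected components.
\<close>

definition subforest :: "'a pair_pre_digraph \<Rightarrow> 'a pair_pre_digraph \<Rightarrow> bool" where
  "subforest s t \<longleftrightarrow>
     (\<exists>F. (\<forall>u \<in> F. subtree u t) \<and>
          (\<forall>u \<in> F. \<forall>v \<in> F. u \<noteq> v \<longrightarrow> pverts u \<inter> pverts v = {}) \<and>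
          s = \<lparr> pverts = (\<Union>u\<in>F. pverts u), parcs = (\<Union>u\<in>F. parcs u) \<rparr>)"

definition covering_subforest :: "'a pair_pre_digraph \<Rightarrow> 'a pair_pre_digraph \<Rightarrow> bool" where
  "covering_subforest s t \<longleftrightarrow> subforest s t \<and> pverts s = pverts t"


section \<open>Contraction\<close>

definition component :: "'a pair_pre_digraph \<Rightarrow> 'a \<Rightarrow> 'a set" where
  "component s v = {w. v \<rightarrow>\<^sup>*\<^bsub>with_proj (mk_symmetric (with_proj s))\<^esub> w}"

text \<open>
  The vertices of a contracted graph are the connected components of \<^term>\<open>s\<close> together with a
  singleton for every vertex outside \<^term>\<open>s\<close>.
\<close>

definition block :: "'a pair_pre_digraph \<Rightarrow> 'a \<Rightarrow> 'a set" where
  "block s v = (if v \<in> pverts s then component s v else {v})"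

definition contract :: "'a pair_pre_digraph \<Rightarrow> 'a pair_pre_digraph \<Rightarrow> 'a set pair_pre_digraph" where
  "contract t s =
     \<lparr> pverts = block s ` pverts t,
       parcs = {(block s u, block s v) | u v. (u, v) \<in> parcs t \<and> block s u \<noteq> block s v} \<rparr>"


section \<open>Admissible cuts\<close>

datatype 'a cut = Total_Cut | Edge_Cut "('a \<times> 'a) set"

fun admissible_cut :: "'a pair_pre_digraph \<Rightarrow> 'a cut \<Rightarrow> bool" where
  "admissible_cut t Total_Cut \<longleftrightarrow> True"
| "admissible_cut t (Edge_Cut c) \<longleftrightarrow>
     c \<subseteq> parcs t \<and>
     (\<forall>r p v. is_root t r \<and> is_leaf t v \<and> pre_digraph.awalk (with_proj t) r p v \<longrightarrow>
        card (set p \<inter> c) \<le> 1)"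

definition above :: "'a pair_pre_digraph \<Rightarrow> ('a \<times> 'a) set \<Rightarrow> 'a set" where
  "above t c = {w. \<exists>(u, v) \<in> c. v \<rightarrow>\<^sup>*\<^bsub>with_proj t\<^esub> w}"

fun pruning :: "'a pair_pre_digraph \<Rightarrow> 'a cut \<Rightarrow> 'a pair_pre_digraph" where
  "pruning t Total_Cut = t"
| "pruning t (Edge_Cut c) = \<lparr> pverts = above t c, parcs = Restr (parcs t) (above t c) \<rparr>"


section \<open>Isomorphism classes of couples\<close>

definition map_graph :: "('a \<Rightarrow> 'b) \<Rightarrow> 'a pair_pre_digraph \<Rightarrow> 'b pair_pre_digraph" where
  "map_graph f t = \<lparr> pverts = f ` pverts t, parcs = map_prod f f ` parcs t \<rparr>"

definition couple_iso ::
    "'a pair_pre_digraph \<times> 'a pair_pre_digraph \<Rightarrow> 'b pair_pre_digraph \<times> 'b pair_pre_digraph \<Rightarrow> bool"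
  where
  "couple_iso p q \<longleftrightarrow>
     (\<exists>f. inj_on f (pverts (fst p)) \<and> q = (map_graph f (fst p), map_graph f (snd p)))"

text \<open>
  Every finite graph has an isomorphic copy on natural numbers, so that an isomorphism class of
  couples over an arbitrary vertex type is determined by its members with vertices in \<^typ>\<open>nat\<close>.
\<close>

definition iso_class ::
    "'a pair_pre_digraph \<times> 'a pair_pre_digraph \<Rightarrow> (nat pair_pre_digraph \<times> nat pair_pre_digraph) set"
  where
  "iso_class p = {q. couple_iso p q}"

lemma subforest_empty: "subforest \<lparr> pverts = {}, parcs = {} \<rparr> t"
  by (auto simp: subforest_def)

text \<open>The basis of the larger space: \<^term>\<open>s\<close> is any subforest of the tree \<^term>\<open>t\<close>.\<close>

typedef couple =
  "{iso_class (t, s) | (t :: nat pair_pre_digraph) s. rooted_tree t \<and> subforest s t}"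
proof -
  let ?t = "\<lparr> pverts = {0}, parcs = {} \<rparr> :: nat pair_pre_digraph"
  have "rooted_tree ?t \<and> subforest \<lparr> pverts = {}, parcs = {} \<rparr> ?t"
    by (intro conjI rooted_tree_singleton subforest_empty)
  then show ?thesis by (intro exI CollectI conjI) (rule refl, auto)
qed

definition couple_of :: "'a pair_pre_digraph \<Rightarrow> 'a pair_pre_digraph \<Rightarrow> couple" where
  "couple_of t s = Abs_couple (iso_class (t, s))"

definition couple_rep :: "couple \<Rightarrow> nat pair_pre_digraph \<times> nat pair_pre_digraph" where
  "couple_rep c = (SOME p. p \<in> Rep_couple c)"

text \<open>The basis of the smaller space: \<^term>\<open>s\<close> is the pruning of \<^term>\<open>t\<close> at an admissible cut.\<close>

typedef cut_couple =
  "{couple_of t (pruning t c) | (t :: nat pair_pre_digraph) c. rooted_tree t \<and> admissible_cut t c}"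
proof -
  let ?t = "\<lparr> pverts = {0}, parcs = {} \<rparr> :: nat pair_pre_digraph"
  have "rooted_tree ?t" "admissible_cut ?t Total_Cut"
    by (simp_all only: rooted_tree_singleton admissible_cut.simps)
  then have "couple_of ?t (pruning ?t Total_Cut)
      \<in> {couple_of t (pruning t c) | (t :: nat pair_pre_digraph) c.
          rooted_tree t \<and> admissible_cut t c}"
    by (intro CollectI exI[of _ ?t] exI[of _ Total_Cut]) simp
  then show ?thesis by (rule exI)
qed

definition cut_couple_of :: "'a pair_pre_digraph \<Rightarrow> 'a pair_pre_digraph \<Rightarrow> cut_couple" where
  "cut_couple_of t s = Abs_cut_couple (couple_of t s)"

definition cut_couple_rep :: "cut_couple \<Rightarrow> nat pair_pre_digraph \<times> nat pair_pre_digraph" where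
  "cut_couple_rep c = couple_rep (Rep_cut_couple c)"


section \<open>Free vector spaces, tensor products and comodules\<close>

text \<open>
  \<^typ>\<open>'a \<Rightarrow>\<^sub>0 'k\<close> is the vector space with basis \<^typ>\<open>'a\<close>, and the tensor product of
  \<^typ>\<open>'a \<Rightarrow>\<^sub>0 'k\<close> and \<^typ>\<open>'b \<Rightarrow>\<^sub>0 'k\<close> is \<^typ>\<open>'a \<times> 'b \<Rightarrow>\<^sub>0 'k\<close>, the pure tensors being given
  by the function \<open>tensor\<close> below; the lemma \<open>tensor_universal\<close> is its universal property.
\<close>

definition scale :: "'k::field \<Rightarrow> ('a \<Rightarrow>\<^sub>0 'k) \<Rightarrow> ('a \<Rightarrow>\<^sub>0 'k)" where
  "scale c = Poly_Mapping.map ((*) c)"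

definition linear_ext :: "('a \<Rightarrow> ('b \<Rightarrow>\<^sub>0 'k)) \<Rightarrow> ('a \<Rightarrow>\<^sub>0 'k::field) \<Rightarrow> ('b \<Rightarrow>\<^sub>0 'k)" where
  "linear_ext f x = (\<Sum>a \<in> Poly_Mapping.keys x. scale (Poly_Mapping.lookup x a) (f a))"

abbreviation basis :: "'a \<Rightarrow> ('a \<Rightarrow>\<^sub>0 'k::field)" where
  "basis a \<equiv> Poly_Mapping.single a 1"

definition tensor :: "('a \<Rightarrow>\<^sub>0 'k::field) \<Rightarrow> ('b \<Rightarrow>\<^sub>0 'k) \<Rightarrow> ('a \<times> 'b \<Rightarrow>\<^sub>0 'k)"
    (infixr \<open>\<otimes>\<^sub>k\<close> 75) where
  "x \<otimes>\<^sub>k y = (\<Sum>a \<in> Poly_Mapping.keys x. \<Sum>b \<in> Poly_Mapping.keys y.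
     Poly_Mapping.single (a, b) (Poly_Mapping.lookup x a * Poly_Mapping.lookup y b))"

definition bilinear :: "(('a \<Rightarrow>\<^sub>0 'k::field) \<Rightarrow> ('b \<Rightarrow>\<^sub>0 'k) \<Rightarrow> ('c \<Rightarrow>\<^sub>0 'k)) \<Rightarrow> bool" where
  "bilinear f \<longleftrightarrow> (\<forall>x. Vector_Spaces.linear scale scale (f x)) \<and>
     (\<forall>y. Vector_Spaces.linear scale scale (\<lambda>x. f x y))"

lemma lookup_scale [simp]: "Poly_Mapping.lookup (scale c x) a = c * Poly_Mapping.lookup x a"
  by (simp add: scale_def Poly_Mapping.map.rep_eq when_def)

lemma scale_single: "scale c (Poly_Mapping.single a d) = Poly_Mapping.single a (c * d)"
  by (intro poly_mapping_eqI) (simp add: lookup_single when_def)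

lemma vector_space_scale: "vector_space (scale :: 'k::field \<Rightarrow> ('a \<Rightarrow>\<^sub>0 'k) \<Rightarrow> _)"
  by unfold_locales (auto intro!: poly_mapping_eqI simp: lookup_add algebra_simps)

lemma linear_ext_superset:
  assumes "finite A" "Poly_Mapping.keys x \<subseteq> A"
  shows "linear_ext f x = (\<Sum>a \<in> A. scale (Poly_Mapping.lookup x a) (f a))"
  unfolding linear_ext_def
  by (rule sum.mono_neutral_left)
     (use assms in \<open>auto intro!: poly_mapping_eqI simp: in_keys_iff\<close>)

lemma linear_linear_ext:
  fixes f :: "'b \<Rightarrow> ('c \<Rightarrow>\<^sub>0 'a::field)"
  shows "Vector_Spaces.linear scale scale (linear_ext f)"
proof -
  interpret A: vector_space "scale :: 'a \<Rightarrow> ('b \<Rightarrow>\<^sub>0 'a) \<Rightarrow> _" by (rule vector_space_scale)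
  interpret B: vector_space "scale :: 'a \<Rightarrow> ('c \<Rightarrow>\<^sub>0 'a) \<Rightarrow> _" by (rule vector_space_scale)
  show ?thesis
  proof (unfold_locales)
    fix x y :: "'b \<Rightarrow>\<^sub>0 'a"
    let ?A = "Poly_Mapping.keys x \<union> Poly_Mapping.keys y"
    show "linear_ext f (x + y) = linear_ext f x + linear_ext f y"
      using keys_add[of x y]
      by (subst (1 2 3) linear_ext_superset[where A = ?A])
         (auto simp: lookup_add B.scale_left_distrib sum.distrib)
  next
    fix c and x :: "'b \<Rightarrow>\<^sub>0 'a"
    show "linear_ext f (scale c x) = scale c (linear_ext f x)"
      by (subst (1 2) linear_ext_superset[where A = "Poly_Mapping.keys x"])
         (auto simp: B.scale_sum_right in_keys_iff)
  qed
qed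

lemma linear_ext_basis [simp]: "linear_ext f (basis a) = f a"
  by (auto simp: linear_ext_def intro!: poly_mapping_eqI)

lemma linear_ext_eqI:
  fixes g :: "('a \<Rightarrow>\<^sub>0 'k::field) \<Rightarrow> ('b \<Rightarrow>\<^sub>0 'k)"
  assumes "Vector_Spaces.linear scale scale g" "\<And>a. g (basis a) = f a"
  shows "g = linear_ext f"
proof
  fix x :: "'a \<Rightarrow>\<^sub>0 'k"
  interpret g: Vector_Spaces.linear scale scale g by (rule assms)
  have "x = (\<Sum>a \<in> Poly_Mapping.keys x. scale (Poly_Mapping.lookup x a) (basis a))"
    by (intro poly_mapping_eqI) 
       (simp add: lookup_sum lookup_single when_def in_keys_iff if_distrib cong: if_cong)
  then have "g x = g (\<Sum>a \<in> Poly_Mapping.keys x. scale (Poly_Mapping.lookup x a) (basis a))"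
    by simp
  also have "\<dots> = linear_ext f x" by (simp add: g.sum g.scale assms(2) linear_ext_def)
  finally show "g x = linear_ext f x" .
qed

lemma tensor_alt:
  fixes x :: "'b \<Rightarrow>\<^sub>0 'a::field" and y :: "'c \<Rightarrow>\<^sub>0 'a"
  shows "x \<otimes>\<^sub>k y = linear_ext (\<lambda>a. linear_ext (\<lambda>b. basis (a, b)) y) x"
proof -
  interpret B: vector_space "scale :: 'a \<Rightarrow> ('b \<times> 'c \<Rightarrow>\<^sub>0 'a) \<Rightarrow> _" by (rule vector_space_scale)
  show ?thesis
    by (simp add: tensor_def linear_ext_def B.scale_sum_right scale_single)
qed

lemma bilinear_tensor:
  "bilinear ((\<otimes>\<^sub>k) :: ('b \<Rightarrow>\<^sub>0 'a::field) \<Rightarrow> ('c \<Rightarrow>\<^sub>0 'a) \<Rightarrow> _)"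
proof -
  interpret B: vector_space "scale :: 'a \<Rightarrow> ('b \<times> 'c \<Rightarrow>\<^sub>0 'a) \<Rightarrow> _" by (rule vector_space_scale)
  have swap: "x \<otimes>\<^sub>k y = linear_ext (\<lambda>b. linear_ext (\<lambda>a. basis (a, b)) x) y"
    for x :: "'b \<Rightarrow>\<^sub>0 'a" and y :: "'c \<Rightarrow>\<^sub>0 'a"
    unfolding tensor_def
    by (subst sum.swap) (simp add: linear_ext_def B.scale_sum_right scale_single mult.commute)
  have "((\<otimes>\<^sub>k) x :: ('c \<Rightarrow>\<^sub>0 'a) \<Rightarrow> _) = linear_ext (\<lambda>b. linear_ext (\<lambda>a. basis (a, b)) x)"
    for x :: "'b \<Rightarrow>\<^sub>0 'a" by (intro ext) (rule swap)
  then show ?thesis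
    unfolding bilinear_def by (metis (no_types, lifting) ext linear_linear_ext tensor_alt)
qed

lemma tensor_universal:
  fixes f :: "('a \<Rightarrow>\<^sub>0 'b::field) \<Rightarrow> ('c \<Rightarrow>\<^sub>0 'b) \<Rightarrow> ('d \<Rightarrow>\<^sub>0 'b)"
  assumes "bilinear f"
  shows "\<exists>!g. Vector_Spaces.linear scale scale g \<and> (\<forall>x y. g (x \<otimes>\<^sub>k y) = f x y)"
proof (rule ex1I)
  let ?g = "linear_ext (\<lambda>(a, b). f (basis a) (basis b))"
  interpret g: Vector_Spaces.linear scale scale ?g by (rule linear_linear_ext)
  have "?g (x \<otimes>\<^sub>k y) = f x y" for x :: "'a \<Rightarrow>\<^sub>0 'b" and y :: "'c \<Rightarrow>\<^sub>0 'b"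
  proof -
    have fx: "Vector_Spaces.linear scale scale (f x)"
      and fy: "Vector_Spaces.linear scale scale (\<lambda>x. f x y)" for x y
      using assms by (auto simp: bilinear_def)
    have "Vector_Spaces.linear scale scale (\<lambda>y. x \<otimes>\<^sub>k y)"
        "Vector_Spaces.linear scale scale (\<lambda>x. x \<otimes>\<^sub>k y)" for x :: "'a \<Rightarrow>\<^sub>0 'b" and y :: "'c \<Rightarrow>\<^sub>0 'b"
      using bilinear_tensor unfolding bilinear_def by auto
    from this[THEN Vector_Spaces.linear_compose, OF linear_linear_ext, unfolded o_def]
    have gt: "Vector_Spaces.linear scale scale (\<lambda>y. ?g (x \<otimes>\<^sub>k y))"
        "Vector_Spaces.linear scale scale (\<lambda>x. ?g (x \<otimes>\<^sub>k y))" for x y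
      by blast+
    have bb: "?g (basis a \<otimes>\<^sub>k basis b) = f (basis a) (basis b)" for a b
      by (simp add: tensor_alt)
    have "?g (basis a \<otimes>\<^sub>k y) = f (basis a) y" for a y
      using linear_ext_eqI[OF gt(1), where f = "\<lambda>b. f (basis a) (basis b)"] linear_ext_eqI[OF fx] bb
      by (metis (no_types, lifting))
    then show ?thesis
      using linear_ext_eqI[OF gt(2), where f = "\<lambda>a. f (basis a) y"] linear_ext_eqI[OF fy]
      by (metis (no_types, lifting))
  qed
  then show "Vector_Spaces.linear scale scale ?g \<and> (\<forall>x y. ?g (x \<otimes>\<^sub>k y) = f x y)"
    by (simp add: linear_linear_ext)
next
  fix g :: "('a \<times> 'c \<Rightarrow>\<^sub>0 'b) \<Rightarrow> ('d \<Rightarrow>\<^sub>0 'b)"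
  assume g: "Vector_Spaces.linear scale scale g \<and> (\<forall>x y. g (x \<otimes>\<^sub>k y) = f x y)"
  show "g = linear_ext (\<lambda>(a, b). f (basis a) (basis b))"
  proof (rule linear_ext_eqI)
    show "g (basis ab) = (case ab of (a, b) \<Rightarrow> f (basis a) (basis b))" for ab
    proof (cases ab)
      case (Pair a b)
      have "basis (a, b) = (basis a :: 'a \<Rightarrow>\<^sub>0 'b) \<otimes>\<^sub>k basis b" by (simp add: tensor_alt)
      then show ?thesis using g Pair by simp
    qed
  qed (use g in blast)
qed

definition tensor_map ::
    "(('a \<Rightarrow>\<^sub>0 'k::field) \<Rightarrow> ('c \<Rightarrow>\<^sub>0 'k)) \<Rightarrow> (('b \<Rightarrow>\<^sub>0 'k) \<Rightarrow> ('d \<Rightarrow>\<^sub>0 'k)) \<Rightarrow>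
     ('a \<times> 'b \<Rightarrow>\<^sub>0 'k) \<Rightarrow> ('c \<times> 'd \<Rightarrow>\<^sub>0 'k)" where
  "tensor_map f g = linear_ext (\<lambda>(a, b). f (basis a) \<otimes>\<^sub>k g (basis b))"

definition tensor_assoc ::
    "(('a \<times> 'b) \<times> 'c \<Rightarrow>\<^sub>0 'k::field) \<Rightarrow> ('a \<times> 'b \<times> 'c \<Rightarrow>\<^sub>0 'k)" where
  "tensor_assoc = linear_ext (\<lambda>((a, b), c). basis (a, b, c))"

text \<open>The maps \<open>\<epsilon> \<otimes> id\<close> and \<open>id \<otimes> \<epsilon>\<close>, composed with the identification of
  \<open>k \<otimes> M\<close> and \<open>M \<otimes> k\<close> with \<open>M\<close>.\<close>

definition counit_tensor_id ::
    "(('a \<Rightarrow>\<^sub>0 'k::field) \<Rightarrow> 'k) \<Rightarrow> ('a \<times> 'b \<Rightarrow>\<^sub>0 'k) \<Rightarrow> ('b \<Rightarrow>\<^sub>0 'k)" where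
  "counit_tensor_id \<epsilon> = linear_ext (\<lambda>(a, b). scale (\<epsilon> (basis a)) (basis b))"

definition id_tensor_counit ::
    "(('b \<Rightarrow>\<^sub>0 'k::field) \<Rightarrow> 'k) \<Rightarrow> ('a \<times> 'b \<Rightarrow>\<^sub>0 'k) \<Rightarrow> ('a \<Rightarrow>\<^sub>0 'k)" where
  "id_tensor_counit \<epsilon> = linear_ext (\<lambda>(a, b). scale (\<epsilon> (basis b)) (basis a))"

definition coalgebra ::
    "(('c \<Rightarrow>\<^sub>0 'k::field) \<Rightarrow> ('c \<times> 'c \<Rightarrow>\<^sub>0 'k)) \<Rightarrow> (('c \<Rightarrow>\<^sub>0 'k) \<Rightarrow> 'k) \<Rightarrow> bool" where
  "coalgebra \<Delta> \<epsilon> \<longleftrightarrow>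
     Vector_Spaces.linear scale scale \<Delta> \<and> Vector_Spaces.linear scale (*) \<epsilon> \<and>
     tensor_assoc \<circ> tensor_map \<Delta> id \<circ> \<Delta> = tensor_map id \<Delta> \<circ> \<Delta> \<and>
     counit_tensor_id \<epsilon> \<circ> \<Delta> = id \<and> id_tensor_counit \<epsilon> \<circ> \<Delta> = id"

definition left_coaction ::
    "(('c \<Rightarrow>\<^sub>0 'k::field) \<Rightarrow> ('c \<times> 'c \<Rightarrow>\<^sub>0 'k)) \<Rightarrow> (('c \<Rightarrow>\<^sub>0 'k) \<Rightarrow> 'k) \<Rightarrow>
     (('m \<Rightarrow>\<^sub>0 'k) \<Rightarrow> ('c \<times> 'm \<Rightarrow>\<^sub>0 'k)) \<Rightarrow> bool" where
  "left_coaction \<Delta> \<epsilon> \<rho> \<longleftrightarrow>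
     Vector_Spaces.linear scale scale \<rho> \<and>
     tensor_assoc \<circ> tensor_map \<Delta> id \<circ> \<rho> = tensor_map id \<rho> \<circ> \<rho> \<and>
     counit_tensor_id \<epsilon> \<circ> \<rho> = id"


section \<open>The symmetric algebras and the maps \<open>\<Gamma>\<close>, \<open>\<epsilon>\<close>, \<open>\<phi>\<close>\<close>

text \<open>
  The symmetric algebra of the space with basis \<^typ>\<open>'c\<close> is the algebra of the free commutative
  monoid \<^typ>\<open>'c multiset\<close>, with the convolution product of \<^typ>\<open>'c multiset \<Rightarrow>\<^sub>0 'k\<close>;
  its unit, the empty monomial, is the couple \<open>(1, 1)\<close>. The product of
  \<^typ>\<open>'c multiset \<times> 'd multiset \<Rightarrow>\<^sub>0 'k\<close> is that of the tensor product of algebras.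
\<close>

type_synonym ('c, 'k) sym = "'c multiset \<Rightarrow>\<^sub>0 'k"

type_synonym 'k D = "(cut_couple, 'k) sym"
type_synonym 'k D_tilde = "(couple, 'k) sym"
type_synonym 'k D_tilde_tensor_D = "couple multiset \<times> cut_couple multiset \<Rightarrow>\<^sub>0 'k"
type_synonym 'k D_tilde_tensor_D_tilde = "couple multiset \<times> couple multiset \<Rightarrow>\<^sub>0 'k"

abbreviation generator :: "'c \<Rightarrow> ('c, 'k::field) sym" where
  "generator c \<equiv> basis {#c#}"

definition mult_ext :: "('c \<Rightarrow> ('b::comm_monoid_add \<Rightarrow>\<^sub>0 'k)) \<Rightarrow> ('c, 'k::field) sym \<Rightarrow> ('b \<Rightarrow>\<^sub>0 'k)"
  where "mult_ext f = linear_ext (\<lambda>m. \<Prod>c \<in># m. f c)"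

definition Gamma_sum ::
    "'a pair_pre_digraph \<Rightarrow> 'a pair_pre_digraph \<Rightarrow> 'k::field D_tilde_tensor_D_tilde" where
  "Gamma_sum t s = (\<Sum>s' | covering_subforest s' s.
     generator (couple_of t s') \<otimes>\<^sub>k generator (couple_of (contract t s') (contract s s')))"

definition phi_sum ::
    "'a pair_pre_digraph \<Rightarrow> 'a pair_pre_digraph \<Rightarrow> 'k::field D_tilde_tensor_D" where
  "phi_sum t s = (\<Sum>s' | covering_subforest s' s.
     generator (couple_of t s') \<otimes>\<^sub>k generator (cut_couple_of (contract t s') (contract s s')))"

text \<open>
  The values on a generator are computed from a chosen representative of the isomorphism class;
  independence of the choice is not built in and has to be proved.
\<close>

definition Gamma :: "'k::field D_tilde \<Rightarrow> 'k D_tilde_tensor_D_tilde" where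
  "Gamma = mult_ext (\<lambda>c. case couple_rep c of (t, s) \<Rightarrow> Gamma_sum t s)"

definition phi :: "'k::field D \<Rightarrow> 'k D_tilde_tensor_D" where
  "phi = mult_ext (\<lambda>c. case cut_couple_rep c of (t, s) \<Rightarrow> phi_sum t s)"

definition counit :: "'k::field D_tilde \<Rightarrow> 'k" where
  "counit x = (\<Sum>m \<in> Poly_Mapping.keys x. Poly_Mapping.lookup x m *
     (\<Prod>c \<in># m. case couple_rep c of (t, s) \<Rightarrow> if parcs s = {} then 1 else 0))"

end

theory Submission
  imports Defs
begin

text \<open>
  Everything rests on one bijection. For a rooted forest \<^term>\<open>s\<close>, a covering subforest is nothing but a
  set of arcs of \<^term>\<open>s\<close>: the vertices are prescribed, and every set of arcs cuts the vertices into
  rooted trees (\<open>covering_subforest_iff\<close>). Fix such a set \<open>v\<close> and contract it. Every block of \<open>v\<close> is a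
  rooted tree, so the only arc that can enter it ends in its root; hence the arcs of \<open>s / v\<close> are
  exactly the arcs of \<^term>\<open>s\<close> outside \<open>v\<close>, and \<open>u \<mapsto> u / v\<close> is a bijection from the covering
  subforests \<open>u\<close> of \<^term>\<open>s\<close> that contain \<open>v\<close> onto the covering subforests of \<open>s / v\<close>
  (\<open>bij_betw_contract_covering\<close>). Moreover contracting \<open>v\<close> and then \<open>u / v\<close> identifies the same
  vertices as contracting \<open>u\<close> (\<open>block_contract_iff\<close>), so that
  \<open>(t / v) / (u / v)\<close> is isomorphic to \<open>t / u\<close>.

  Both iterated coproducts of a couple \<open>(t, s)\<close> are therefore the sum over all chains
  \<open>v \<subseteq> u \<subseteq> s\<close> of the terms \<open>(t, v) \<otimes> (t / v, u / v) \<otimes> (t / u, s / u)\<close>: one of them sums over \<open>u\<close>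
  first, the other over \<open>v\<close> first (\<open>coassoc_on_generator\<close>). The counit looks only for arcs in the
  second component of a couple: \<open>u\<close> has none only if it is the arcless covering subforest, and then
  \<open>(t / u, s / u)\<close> is \<open>(t, s)\<close> again, while \<open>s / u\<close> has none only for \<open>u = s\<close>. This gives
  the two counit axioms. As \<open>\<Gamma>\<close>, \<open>\<phi>\<close> and all the maps built from
  them are algebra homomorphisms, identities on generators suffice (\<open>alg_hom_eqI\<close>).

  The map \<open>\<phi>\<close> has the same formula as \<open>\<Gamma>\<close>; only the second tensor factor is read in a different basis.
  That it is well defined follows from a description of prunings without cuts: they are the
  subgraphs induced on vertex sets closed under passing to children
  (\<open>pruning_iff_up_closed\<close>), a property that contraction visibly preserves
  (\<open>up_closed_contract\<close>). The remaining work is to see that every construction respects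
  isomorphism of couples, which is needed because the maps are defined through chosen
  representatives.
\<close>

section \<open>Rooted trees and forests as relations\<close>

text \<open>
  A vertex with no parent from which every vertex can be reached, in a graph where parents are
  unique. Connectedness, acyclicity and the degree conditions are all packed into reachability and
  uniqueness of parents, which pass to contractions easily.
\<close>

definition rooted_at :: "'a pair_pre_digraph \<Rightarrow> 'a \<Rightarrow> bool" where
  "rooted_at t r \<longleftrightarrow> finite (pverts t) \<and> parcs t \<subseteq> pverts t \<times> pverts t \<and> r \<in> pverts t \<and>
     (\<forall>u. (u, r) \<notin> parcs t) \<and>
     (\<forall>u u' v. (u, v) \<in> parcs t \<longrightarrow> (u', v) \<in> parcs t \<longrightarrow> u = u') \<and>
     (\<forall>v \<in> pverts t. (r, v) \<in> (parcs t)\<^sup>*)"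

lemma rooted_atD:
  assumes "rooted_at t r"
  shows "finite (pverts t)" "parcs t \<subseteq> pverts t \<times> pverts t" "r \<in> pverts t" "(u, r) \<notin> parcs t"
    "(u, v) \<in> parcs t \<Longrightarrow> (u', v) \<in> parcs t \<Longrightarrow> u = u'" "v \<in> pverts t \<Longrightarrow> (r, v) \<in> (parcs t)\<^sup>*"
  using assms unfolding rooted_at_def by blast+

definition rooted_forest :: "'a pair_pre_digraph \<Rightarrow> bool" where
  "rooted_forest s \<longleftrightarrow> finite (pverts s) \<and> parcs s \<subseteq> pverts s \<times> pverts s \<and>
     (\<forall>u u' v. (u, v) \<in> parcs s \<longrightarrow> (u', v) \<in> parcs s \<longrightarrow> u = u') \<and> acyclic (parcs s)"

lemma rooted_forest_parent_unique:
  "rooted_forest s \<Longrightarrow> (u, v) \<in> parcs s \<Longrightarrow> (u', v) \<in> parcs s \<Longrightarrow> u = u'"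
  unfolding rooted_forest_def by blast

lemma rooted_forest_finite: "rooted_forest s \<Longrightarrow> finite (pverts s)" "rooted_forest s \<Longrightarrow> finite (parcs s)"
  unfolding rooted_forest_def using finite_subset[of "parcs s" "pverts s \<times> pverts s"] by auto

text \<open>
  The reachability relation of the graph library is reflexive only on vertices; once the starting
  point is a vertex it is the plain reflexive transitive closure.
\<close>

lemma reachable_with_proj:
  assumes "parcs t \<subseteq> pverts t \<times> pverts t" "u \<in> pverts t"
  shows "u \<rightarrow>\<^sup>*\<^bsub>with_proj t\<^esub> v \<longleftrightarrow> (u, v) \<in> (parcs t)\<^sup>*"
proof
  assume "(u, v) \<in> (parcs t)\<^sup>*"
  then show "u \<rightarrow>\<^sup>*\<^bsub>with_proj t\<^esub> v"
    unfolding reachable_def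
  proof (induction rule: rtrancl_induct)
    case base
    then show ?case using assms by auto
  next
    case (step y z)
    then show ?case using assms by (auto intro: rtrancl_on_into_rtrancl_on)
  qed
qed (auto simp: reachable_def dest: rtrancl_on_rtranclI)

text \<open>
  Lying in the same undirected component. Points without arcs are linked to themselves, so that no
  vertex set has to be carried along.
\<close>

definition linked :: "'a rel \<Rightarrow> 'a rel" where
  "linked A = (A \<union> A\<inverse>)\<^sup>*"

lemma linked_refl: "(u, u) \<in> linked A"
  by (simp add: linked_def)

lemma linked_sym: "(u, v) \<in> linked A \<Longrightarrow> (v, u) \<in> linked A"
  unfolding linked_def by (metis converse_Un converse_converse rtrancl_converseI sup_commute)

lemma linked_trans: "(u, v) \<in> linked A \<Longrightarrow> (v, w) \<in> linked A \<Longrightarrow> (u, w) \<in> linked A"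
  unfolding linked_def by (rule rtrancl_trans)

lemma linked_arc: "(u, v) \<in> A \<Longrightarrow> (u, v) \<in> linked A"
  unfolding linked_def by auto

lemma rtrancl_imp_linked: "(u, v) \<in> A\<^sup>* \<Longrightarrow> (u, v) \<in> linked A"
  unfolding linked_def by (rule in_rtrancl_UnI, rule disjI1)

lemma linked_mono: "A \<subseteq> B \<Longrightarrow> linked A \<subseteq> linked B"
  unfolding linked_def by (intro rtrancl_mono) auto

lemma linked_induct [consumes 1, case_names refl forward backward]:
  assumes "(u, v) \<in> linked A" "P u"
    and "\<And>y z. (u, y) \<in> linked A \<Longrightarrow> P y \<Longrightarrow> (y, z) \<in> A \<Longrightarrow> P z"
    and "\<And>y z. (u, y) \<in> linked A \<Longrightarrow> P y \<Longrightarrow> (z, y) \<in> A \<Longrightarrow> P z"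
  shows "P v"
  using assms(1) unfolding linked_def
proof (induction rule: rtrancl_induct)
  case (step y z)
  then have "(u, y) \<in> linked A" by (simp add: linked_def)
  moreover have "(y, z) \<in> A \<or> (z, y) \<in> A" using step.hyps by blast
  ultimately show ?case using assms(3,4) step.IH by metis
qed (fact assms(2))

lemma linked_in_verts:
  assumes "A \<subseteq> V \<times> V" "(u, v) \<in> linked A" "u \<in> V"
  shows "v \<in> V"
  using assms(2) by (induction rule: linked_induct) (use assms(1,3) in auto)

lemma linked_outside:
  assumes "A \<subseteq> V \<times> V" "(u, v) \<in> linked A" "u \<notin> V"
  shows "v = u"
  using assms(2) by (induction rule: linked_induct) (use assms(1,3) in auto)

text \<open>
  An undirected walk starting at a parentless vertex can be straightened into a directed one: a
  step backwards leads to the unique parent, which the directed walk has just left.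
\<close>

lemma linked_from_parentless:
  assumes uniq: "\<And>u u' v. (u, v) \<in> A \<Longrightarrow> (u', v) \<in> A \<Longrightarrow> u = u'"
    and top: "\<And>u. (u, v) \<notin> A" and "(v, w) \<in> linked A"
  shows "(v, w) \<in> A\<^sup>*"
  using assms(3)
proof (induction rule: linked_induct)
  case (backward y z)
  then have "y \<noteq> v" using top by auto
  then obtain x where "(v, x) \<in> A\<^sup>*" "(x, y) \<in> A"
    using backward.IH by (metis rtranclE)
  then show ?case using uniq backward by metis
qed auto

text \<open>
  A cycle through a vertex also passes through its unique parent, so that it could be pushed back
  along the path from the root until it reaches the root, which has no parent.
\<close>

lemma rooted_at_acyclic:
  assumes "rooted_at t r"
  shows "acyclic (parcs t)"
proof -
  let ?E = "parcs t"
  have uniq: "\<And>u u' v. (u, v) \<in> ?E \<Longrightarrow> (u', v) \<in> ?E \<Longrightarrow> u = u'"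
    and noin: "\<And>u. (u, r) \<notin> ?E"
    and reach: "\<And>v. v \<in> pverts t \<Longrightarrow> (r, v) \<in> ?E\<^sup>*"
    and wf: "?E \<subseteq> pverts t \<times> pverts t"
    using assms unfolding rooted_at_def by auto
  have "(v, v) \<notin> ?E\<^sup>+" if "(r, v) \<in> ?E\<^sup>*" for v
    using that
  proof (induction rule: rtrancl_induct)
    case base
    then show ?case using noin by (meson tranclD2)
  next
    case (step y z)
    show ?case
    proof
      assume "(z, z) \<in> ?E\<^sup>+"
      then obtain w where "(z, w) \<in> ?E\<^sup>*" "(w, z) \<in> ?E" by (meson tranclD2)
      then have "(z, y) \<in> ?E\<^sup>*" using uniq step by metis
      then have "(y, y) \<in> ?E\<^sup>+" using step by (meson rtrancl_into_trancl2)
      then show False using step by simp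
    qed
  qed
  moreover have "v \<in> pverts t" if "(v, v) \<in> ?E\<^sup>+" for v
    using that wf by (meson tranclD mem_Sigma_iff subsetD)
  ultimately show ?thesis using reach unfolding acyclic_def by blast
qed

lemma rooted_at_imp_forest: "rooted_at t r \<Longrightarrow> rooted_forest t"
  using rooted_at_acyclic[of t r] unfolding rooted_forest_def rooted_at_def by blast

text \<open>
  From a rooted tree, reachability is obtained from connectedness by straightening undirected
  walks that start at the root.
\<close>

lemma rooted_tree_iff: "rooted_tree t \<longleftrightarrow> (\<exists>r. rooted_at t r)"
proof
  assume t: "rooted_tree t"
  then interpret t: pair_digraph t by (simp add: rooted_tree_def)
  let ?E = "parcs t"
  obtain r where r: "is_root t r"
    and indeg: "\<And>v. v \<in> pverts t - {r} \<Longrightarrow> in_degree (with_proj t) v = 1"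
    using t unfolding rooted_tree_def by blast
  have wf: "?E \<subseteq> pverts t \<times> pverts t"
    using t.arc_fst_in_verts t.arc_snd_in_verts by fastforce
  have in_arcs: "in_arcs (with_proj t) v = {e \<in> ?E. snd e = v}" for v
    by (simp add: in_arcs_def)
  have rV: "r \<in> pverts t" and noin: "(u, r) \<notin> ?E" for u
  proof -
    have "in_arcs (with_proj t) r = {}"
      using r t.finite_arcs unfolding is_root_def in_degree_def in_arcs by simp
    then show "(u, r) \<notin> ?E" by (auto simp: in_arcs)
  qed (use r in \<open>simp add: is_root_def\<close>)
  have uniq: "u = u'" if "(u, v) \<in> ?E" "(u', v) \<in> ?E" for u u' v
  proof -
    have "v \<in> pverts t - {r}" using noin that wf by auto
    then have "card {e \<in> ?E. snd e = v} = 1"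
      using indeg by (simp add: in_degree_def in_arcs)
    then obtain e where "{e \<in> ?E. snd e = v} = {e}" by (auto simp: card_1_singleton_iff)
    moreover have "(u, v) \<in> {e \<in> ?E. snd e = v}" "(u', v) \<in> {e \<in> ?E. snd e = v}"
      using that by auto
    ultimately show ?thesis by (metis prod.inject singletonD)
  qed
  have "(r, v) \<in> ?E\<^sup>*" if "v \<in> pverts t" for v
  proof (rule linked_from_parentless[OF uniq noin])
    have "r \<rightarrow>\<^sup>*\<^bsub>with_proj (mk_symmetric (with_proj t))\<^esub> v"
      using t rV that
      unfolding rooted_tree_def connected_def strongly_connected_def
      by (auto simp: mk_symmetric_def)
    then have "(r, v) \<in> rtrancl_on (pverts t) (\<Union>e\<in>?E. {(fst e, snd e), (snd e, fst e)})"
      by (simp add: reachable_def mk_symmetric_def)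
    moreover have "(\<Union>e\<in>?E. {(fst e, snd e), (snd e, fst e)}) = ?E \<union> ?E\<inverse>" by auto
    ultimately show "(r, v) \<in> linked ?E" unfolding linked_def
      by (metis rtrancl_on_rtranclI)
  qed
  then show "\<exists>r. rooted_at t r"
    unfolding rooted_at_def using wf rV noin uniq t.pair_finite_verts by blast
next
  assume "\<exists>r. rooted_at t r"
  then obtain r where r: "rooted_at t r" by blast
  let ?E = "parcs t"
  have fin: "finite (pverts t)" "finite ?E"
    using rooted_forest_finite rooted_at_imp_forest[OF r] by auto
  have uniq: "\<And>u u' v. (u, v) \<in> ?E \<Longrightarrow> (u', v) \<in> ?E \<Longrightarrow> u = u'"
    and noin: "\<And>u. (u, r) \<notin> ?E" and rV: "r \<in> pverts t"
    and reach: "\<And>v. v \<in> pverts t \<Longrightarrow> (r, v) \<in> ?E\<^sup>*"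
    and wf: "?E \<subseteq> pverts t \<times> pverts t"
    using r unfolding rooted_at_def by auto
  show "rooted_tree t"
  proof (rule rooted_treeI)
    show "pair_fin_digraph t" by unfold_locales (use fin wf in auto)
    show "is_root t r" using rV noin
      by (auto simp: is_root_def in_degree_def in_arcs_def card_eq_0_iff)
    show "in_degree (with_proj t) v = 1" if vr: "v \<in> pverts t" "v \<noteq> r" for v
    proof -
      obtain u where u: "(u, v) \<in> ?E"
        using reach[OF vr(1)] vr(2) by (cases rule: rtranclE) auto
      then have "{e \<in> ?E. snd e = v} \<subseteq> {(u, v)}"
        using uniq[of _ v u] by force
      then have "{e \<in> ?E. snd e = v} = {(u, v)}" using u by auto
      then have "in_arcs (with_proj t) v = {(u, v)}" by (simp add: in_arcs_def)
      then show ?thesis by (simp add: in_degree_def)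
    qed
    have mk: "mk_symmetric (with_proj t) = \<lparr>pverts = pverts t, parcs = ?E \<union> ?E\<inverse>\<rparr>"
      by (auto simp: mk_symmetric_def)
    have "(u, v) \<in> linked ?E" if "u \<in> pverts t" "v \<in> pverts t" for u v
    proof -
      show ?thesis
        using that[THEN reach, THEN rtrancl_imp_linked] by (meson linked_sym linked_trans)
    qed
    moreover have "u \<rightarrow>\<^sup>*\<^bsub>with_proj \<lparr>pverts = pverts t, parcs = ?E \<union> ?E\<inverse>\<rparr>\<^esub> v \<longleftrightarrow> (u, v) \<in> linked ?E"
      if "u \<in> pverts t" for u v
      unfolding linked_def by (subst reachable_with_proj) (use wf that in auto)
    ultimately show "connected (with_proj t)"
      unfolding connected_def strongly_connected_def mk using rV by auto
  qed
qed


lemma rooted_at_imp_tree: "rooted_at t r \<Longrightarrow> rooted_tree t"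
  unfolding rooted_tree_iff by (rule exI)

lemma rooted_treeE:
  assumes "rooted_tree t"
  obtains r where "rooted_at t r"
  using assms unfolding rooted_tree_iff by (rule exE)


section \<open>Subforests of a rooted forest\<close>

text \<open>
  Being a subforest of a rooted forest, with the trees that make it up left out.
\<close>

definition sub_graph :: "'a pair_pre_digraph \<Rightarrow> 'a pair_pre_digraph \<Rightarrow> bool" where
  "sub_graph s t \<longleftrightarrow> pverts s \<subseteq> pverts t \<and> parcs s \<subseteq> parcs t \<and> parcs s \<subseteq> pverts s \<times> pverts s"

lemma sub_graph_trans: "sub_graph u s \<Longrightarrow> sub_graph s t \<Longrightarrow> sub_graph u t"
  unfolding sub_graph_def by blast

lemma sub_graph_forest: "sub_graph s t \<Longrightarrow> rooted_forest t \<Longrightarrow> rooted_forest s"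
  unfolding sub_graph_def rooted_forest_def
  by (meson acyclic_subset finite_subset subsetD)

text \<open>
  A subgraph of a rooted forest decomposes into the trees above its parentless vertices: following
  parents downwards from any vertex ends at such a vertex, and by uniqueness of parents at only one.
\<close>

lemma subforest_iff:
  assumes t: "rooted_forest t"
  shows "subforest s t \<longleftrightarrow> sub_graph s t"
proof
  assume "subforest s t"
  then obtain F where F: "\<And>u. u \<in> F \<Longrightarrow> subtree u t"
    and s: "s = \<lparr>pverts = (\<Union>u\<in>F. pverts u), parcs = (\<Union>u\<in>F. parcs u)\<rparr>"
    unfolding subforest_def by blast
  have "pverts u \<subseteq> pverts t \<and> parcs u \<subseteq> parcs t \<and> parcs u \<subseteq> pverts u \<times> pverts u"
    if "u \<in> F" for u
    using F[OF that] unfolding subtree_def rooted_tree_iff rooted_at_def subgraph_def by auto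
  then show "sub_graph s t"
    unfolding s sub_graph_def by fastforce
next
  assume st: "sub_graph s t"
  let ?A = "parcs s"
  have s: "rooted_forest s" using st t by (rule sub_graph_forest)
  have uniq: "\<And>u u' v. (u, v) \<in> ?A \<Longrightarrow> (u', v) \<in> ?A \<Longrightarrow> u = u'"
    and ac: "acyclic ?A" and fin: "finite (pverts s)" "finite ?A"
    and wf: "?A \<subseteq> pverts s \<times> pverts s"
    using s rooted_forest_finite[OF s] unfolding rooted_forest_def by auto
  \<comment> \<open>the roots of the trees of \<^term>\<open>s\<close>, and the tree above each of them\<close>
  define R where "R = {v \<in> pverts s. \<forall>u. (u, v) \<notin> ?A}"
  define up where "up v = \<lparr>pverts = ?A\<^sup>* `` {v}, parcs = Restr ?A (?A\<^sup>* `` {v})\<rparr>" for v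
  have upV: "?A\<^sup>* `` {v} \<subseteq> pverts s" if "v \<in> R" for v
  proof
    fix w assume "w \<in> ?A\<^sup>* `` {v}"
    then have "(v, w) \<in> ?A\<^sup>*" by simp
    then show "w \<in> pverts s"
      by (induction rule: rtrancl_induct) (use that wf in \<open>auto simp: R_def\<close>)
  qed
  have tree: "rooted_at (up v) v" if v: "v \<in> R" for v
  proof -
    have "(v, w) \<in> (Restr ?A (?A\<^sup>* `` {v}))\<^sup>*" if "(v, w) \<in> ?A\<^sup>*" for w
      using that
    proof (induction rule: rtrancl_induct)
      case (step y z)
      then have "(y, z) \<in> Restr ?A (?A\<^sup>* `` {v})" by (auto intro: rtrancl_into_rtrancl)
      then show ?case using step.IH by (rule rtrancl_into_rtrancl[rotated])
    qed simp
    moreover have "finite (?A\<^sup>* `` {v})" using upV[OF v] fin finite_subset by blast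
    ultimately show ?thesis
      using v uniq unfolding rooted_at_def up_def R_def
      by (simp, blast)
  qed
  have disj: "v = w" if "v \<in> R" "w \<in> R" "(v, x) \<in> ?A\<^sup>*" "(w, x) \<in> ?A\<^sup>*" for v w x
  proof -
    have "(v, w) \<in> linked ?A"
      using that(3,4)[THEN rtrancl_imp_linked] by (meson linked_sym linked_trans)
    then have "(v, w) \<in> ?A\<^sup>*"
      by (rule linked_from_parentless[OF uniq, rotated 3]) (use that(1) in \<open>auto simp: R_def\<close>)
    then show ?thesis using that(2) unfolding R_def by (cases rule: rtranclE) auto
  qed
  have root: "\<exists>v \<in> R. (v, x) \<in> ?A\<^sup>*" if "x \<in> pverts s" for x
  proof -
    have "wf ?A" using fin(2) ac by (rule finite_acyclic_wf)
    then show ?thesis using that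
    proof (induction x rule: wf_induct_rule)
      case (less x)
      show ?case
      proof (cases "x \<in> R")
        case False
        then obtain y where y: "(y, x) \<in> ?A" using less.prems by (auto simp: R_def)
        then obtain v where "v \<in> R" "(v, y) \<in> ?A\<^sup>*" using less.IH wf by blast
        then show ?thesis using y by (meson rtrancl_into_rtrancl)
      qed auto
    qed
  qed
  have "subtree (up v) t" if v: "v \<in> R" for v
  proof -
    have "pair_wf_digraph t" using t by unfold_locales (auto simp: rooted_forest_def)
    moreover have "pair_wf_digraph (up v)"
      using tree[OF v] by unfold_locales (auto simp: rooted_at_def)
    ultimately show ?thesis
      using tree[OF v] upV[OF v] st
      unfolding subtree_def subgraph_def rooted_tree_iff wf_digraph_wp_iff compatible_def
      by (auto simp: up_def sub_graph_def)
  qed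
  moreover have "pverts (up v) \<inter> pverts (up w) = {}" if "v \<in> R" "w \<in> R" "up v \<noteq> up w" for v w
    using disj that by (auto simp: up_def)
  moreover have "s = \<lparr>pverts = (\<Union>u\<in>up ` R. pverts u), parcs = (\<Union>u\<in>up ` R. parcs u)\<rparr>"
  proof -
    have "pverts s \<subseteq> (\<Union>u\<in>up ` R. pverts u)"
      using root by (simp add: up_def subset_iff)
    moreover have "(\<Union>u\<in>up ` R. pverts u) \<subseteq> pverts s"
      using upV by (simp add: up_def UN_subset_iff)
    moreover have "?A \<subseteq> (\<Union>u\<in>up ` R. parcs u)"
    proof
      fix e assume e: "e \<in> ?A"
      obtain x y where xy: "e = (x, y)" by (cases e)
      then obtain v where "v \<in> R" "(v, x) \<in> ?A\<^sup>*" using root e wf by blast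
      then show "e \<in> (\<Union>u\<in>up ` R. parcs u)"
        using e xy by (auto simp: up_def intro: rtrancl_into_rtrancl)
    qed
    ultimately show ?thesis by (cases s) (auto simp: up_def)
  qed
  ultimately show "subforest s t"
    unfolding subforest_def by (intro exI[of _ "up ` R"]) auto
qed

text \<open>
  This is what makes the sums over covering subforests manageable: the summation index is just a set
  of arcs.
\<close>

lemma covering_subforest_iff:
  "rooted_forest t \<Longrightarrow> covering_subforest s t \<longleftrightarrow> pverts s = pverts t \<and> parcs s \<subseteq> parcs t"
  unfolding covering_subforest_def by (auto simp: subforest_iff sub_graph_def rooted_forest_def)

lemma covering_imp_sub_graph: "rooted_forest t \<Longrightarrow> covering_subforest s t \<Longrightarrow> sub_graph s t"
  by (simp add: covering_subforest_def subforest_iff)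

lemma finite_covering_subforests:
  assumes "rooted_forest t"
  shows "finite {s. covering_subforest s t}"
proof (rule finite_subset)
  show "{s. covering_subforest s t} \<subseteq> (\<lambda>A. \<lparr>pverts = pverts t, parcs = A\<rparr>) ` Pow (parcs t)"
  proof
    fix s assume "s \<in> {s. covering_subforest s t}"
    then have "s = \<lparr>pverts = pverts t, parcs = parcs s\<rparr>" "parcs s \<in> Pow (parcs t)"
      by (cases s; simp add: covering_subforest_iff[OF assms])+
    then show "s \<in> (\<lambda>A. \<lparr>pverts = pverts t, parcs = A\<rparr>) ` Pow (parcs t)" by blast
  qed
qed (use rooted_forest_finite(2)[OF assms] in simp)


section \<open>Contraction\<close>

text \<open>
  The image of a graph under a map of its vertices, without the loops this creates. Contraction is the
  case of the map to blocks; keeping the map arbitrary lets iterated contractions be compared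
  through their composed maps.
\<close>

definition quot :: "('a \<Rightarrow> 'b) \<Rightarrow> 'a pair_pre_digraph \<Rightarrow> 'b pair_pre_digraph" where
  "quot h t = \<lparr>pverts = h ` pverts t, parcs = {(h u, h v) | u v. (u, v) \<in> parcs t \<and> h u \<noteq> h v}\<rparr>"

lemma contract_eq_quot: "contract t s = quot (block s) t"
  by (simp add: contract_def quot_def)

lemma pverts_quot [simp]: "pverts (quot h t) = h ` pverts t"
  by (simp add: quot_def)

lemma parcs_quot: "parcs (quot h t) = {(h u, h v) | u v. (u, v) \<in> parcs t \<and> h u \<noteq> h v}"
  by (simp add: quot_def)

lemma mem_parcs_quot:
  "(x, y) \<in> parcs (quot h t) \<longleftrightarrow> (\<exists>u v. (u, v) \<in> parcs t \<and> x = h u \<and> y = h v \<and> h u \<noteq> h v)"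
  by (auto simp: quot_def)

lemma quot_quot: "quot g (quot h t) = quot (g \<circ> h) t"
proof -
  have "(x, y) \<in> parcs (quot g (quot h t)) \<longleftrightarrow> (x, y) \<in> parcs (quot (g \<circ> h) t)" for x y
    unfolding mem_parcs_quot o_def by metis
  then have "parcs (quot g (quot h t)) = parcs (quot (g \<circ> h) t)" by auto
  moreover have "pverts (quot g (quot h t)) = pverts (quot (g \<circ> h) t)"
    by (simp add: image_comp)
  ultimately show ?thesis by simp
qed

text \<open>
  The case distinction in the definition of a block disappears, since a vertex outside
  \<^term>\<open>s\<close> is linked to itself only.
\<close>

lemma block_eq_linked:
  assumes wf: "parcs s \<subseteq> pverts s \<times> pverts s"
  shows "block s v = linked (parcs s) `` {v}"
proof (cases "v \<in> pverts s")
  case True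
  have "mk_symmetric (with_proj s) = \<lparr>pverts = pverts s, parcs = parcs s \<union> (parcs s)\<inverse>\<rparr>"
    by (auto simp: mk_symmetric_def)
  then have "v \<rightarrow>\<^sup>*\<^bsub>with_proj (mk_symmetric (with_proj s))\<^esub> w \<longleftrightarrow> (v, w) \<in> linked (parcs s)" for w
    using wf True by (simp add: linked_def, subst reachable_with_proj) auto
  then show ?thesis using True by (auto simp: block_def component_def)
next
  case False
  then show ?thesis
    using linked_outside[OF wf] by (auto simp: block_def linked_refl)
qed

lemma block_eq_iff:
  assumes "parcs s \<subseteq> pverts s \<times> pverts s"
  shows "block s u = block s v \<longleftrightarrow> (u, v) \<in> linked (parcs s)"
proof
  show "(u, v) \<in> linked (parcs s)" if "block s u = block s v"
    using that linked_refl[of v] unfolding block_eq_linked[OF assms] by blast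
  show "block s u = block s v" if "(u, v) \<in> linked (parcs s)"
    using linked_trans[OF that] linked_trans[OF linked_sym[OF that]]
    unfolding block_eq_linked[OF assms] by blast
qed

text \<open>
  Otherwise the end \<^term>\<open>v\<close> of the arc would have no parent in \<^term>\<open>A\<close>, because its only parent is
  \<^term>\<open>u\<close>, and straightening the walk from \<^term>\<open>v\<close> to \<^term>\<open>u\<close> would close a directed cycle.
\<close>

lemma linked_arc_of_forest:
  assumes t: "rooted_forest t" and A: "A \<subseteq> parcs t"
    and uv: "(u, v) \<in> parcs t" "(u, v) \<in> linked A"
  shows "(u, v) \<in> A"
proof (rule ccontr)
  assume "(u, v) \<notin> A"
  then have "\<And>w. (w, v) \<notin> A" using rooted_forest_parent_unique[OF t] A uv by blast
  moreover have "\<And>u u' v. (u, v) \<in> A \<Longrightarrow> (u', v) \<in> A \<Longrightarrow> u = u'"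
    using rooted_forest_parent_unique[OF t] A by blast
  ultimately have "(v, u) \<in> A\<^sup>*" using linked_from_parentless linked_sym[OF uv(2)] by metis
  then have "(v, u) \<in> (parcs t)\<^sup>*" using A rtrancl_mono by blast
  then have "(u, u) \<in> (parcs t)\<^sup>+" using uv(1) by (rule rtrancl_into_trancl2[rotated])
  then show False using t by (auto simp: rooted_forest_def acyclic_def)
qed

lemma block_eq_arc_iff:
  assumes "rooted_forest t" "sub_graph s t" "(u, v) \<in> parcs t"
  shows "block s u = block s v \<longleftrightarrow> (u, v) \<in> parcs s"
  using assms linked_arc_of_forest[of t "parcs s" u v] linked_arc
  by (auto simp: sub_graph_def block_eq_iff)

text \<open>
  Each block is a tree and has only one root.
\<close>

lemma parentless_block_unique:
  assumes t: "rooted_forest t" and s: "sub_graph s t"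
    and "\<And>u. (u, v) \<notin> parcs s" "\<And>u. (u, v') \<notin> parcs s" "block s v = block s v'"
  shows "v = v'"
proof -
  have "(v, v') \<in> linked (parcs s)" using assms by (auto simp: sub_graph_def block_eq_iff)
  then have "(v, v') \<in> (parcs s)\<^sup>*"
    using rooted_forest_parent_unique[OF sub_graph_forest[OF s t]] assms(3)
    by (intro linked_from_parentless)
  then show ?thesis using assms(4) by (metis rtranclE)
qed

text \<open>
  An arc entering a block from outside ends at a vertex with no parent inside, which is the root of
  the block.
\<close>

lemma arc_into_block_unique:
  assumes t: "rooted_forest t" and s: "sub_graph s t"
    and uv: "(u, v) \<in> parcs t" "block s u \<noteq> block s v"
    and uv': "(u', v') \<in> parcs t" "block s u' \<noteq> block s v'"
    and eq: "block s v = block s v'"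
  shows "u = u' \<and> v = v'"
proof -
  have "\<And>w. (w, v) \<notin> parcs s" "\<And>w. (w, v') \<notin> parcs s"
    using block_eq_arc_iff[OF t s] uv uv' rooted_forest_parent_unique[OF t] s
    unfolding sub_graph_def by (metis subsetD)+
  then have "v = v'" using parentless_block_unique[OF t s] eq by blast
  then show ?thesis using rooted_forest_parent_unique[OF t] uv uv' by blast
qed

lemma quot_sub_graph:
  "sub_graph s t \<Longrightarrow> sub_graph (quot h s) (quot h t)"
  unfolding sub_graph_def by (fastforce simp: parcs_quot)

lemma contract_sub_graph: "sub_graph s t \<Longrightarrow> sub_graph (contract s s') (contract t s')"
  unfolding contract_eq_quot by (rule quot_sub_graph)

text \<open>
  A contraction inherits uniqueness of parents from the uniqueness of the arc into a block, and
  reachability by taking the image of paths.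
\<close>

lemma rooted_at_contract:
  assumes t: "rooted_at t r" and s: "sub_graph s t"
  shows "rooted_at (contract t s) (block s r)"
proof -
  have f: "rooted_forest t" using t by (rule rooted_at_imp_forest)
  let ?E = "parcs t" and ?Q = "parcs (quot (block s) t)"
  have noin: "\<And>u. (u, r) \<notin> ?E" and rV: "r \<in> pverts t"
    and reach: "\<And>v. v \<in> pverts t \<Longrightarrow> (r, v) \<in> ?E\<^sup>*"
    and wf: "?E \<subseteq> pverts t \<times> pverts t" and fin: "finite (pverts t)"
    using t unfolding rooted_at_def by auto
  have "(X, block s r) \<notin> ?Q" for X
  proof
    assume "(X, block s r) \<in> ?Q"
    then obtain u v where uv: "(u, v) \<in> ?E" "block s v = block s r" "block s u \<noteq> block s v"
      by (auto simp: parcs_quot)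
    have "\<And>w. (w, v) \<notin> parcs s"
      using block_eq_arc_iff[OF f s] uv rooted_forest_parent_unique[OF f] s
      unfolding sub_graph_def by (metis subsetD)
    moreover have "\<And>w. (w, r) \<notin> parcs s" using noin s by (auto simp: sub_graph_def)
    ultimately have "v = r" using parentless_block_unique[OF f s] uv by blast
    then show False using noin uv by auto
  qed
  moreover have "X = X'" if XY: "(X, Y) \<in> ?Q" "(X', Y) \<in> ?Q" for X X' Y
  proof -
    obtain u v where uv: "X = block s u" "Y = block s v" "(u, v) \<in> ?E" "block s u \<noteq> block s v"
      using XY(1) unfolding parcs_quot by auto
    obtain u' v' where uv': "X' = block s u'" "Y = block s v'" "(u', v') \<in> ?E" "block s u' \<noteq> block s v'"
      using XY(2) unfolding parcs_quot by auto
    show ?thesis using arc_into_block_unique[OF f s uv(3,4) uv'(3,4)] uv uv' by metis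
  qed
  moreover have "(block s r, block s v) \<in> ?Q\<^sup>*" if "v \<in> pverts t" for v
    using reach[OF that]
  proof (induction rule: rtrancl_induct)
    case (step y z)
    show ?case
    proof (cases "block s y = block s z")
      case False
      then have "(block s y, block s z) \<in> ?Q" using step by (auto simp: parcs_quot)
      then show ?thesis using step.IH by (rule rtrancl_into_rtrancl[rotated])
    qed (use step in simp)
  qed simp
  moreover have "?Q \<subseteq> block s ` pverts t \<times> block s ` pverts t" using wf by (auto simp: parcs_quot)
  ultimately show ?thesis
    unfolding rooted_at_def contract_eq_quot pverts_quot using fin rV by blast
qed

text \<open>
  An arc of \<^term>\<open>t\<close> outside \<^term>\<open>s\<close> survives the contraction and can be recovered from its image,
  so the sets of arcs between \<^term>\<open>s\<close> and \<^term>\<open>t\<close> correspond to the sets of arcs of the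
  contraction.
\<close>

lemma bij_betw_contract_covering:
  assumes t: "rooted_forest t" and t': "rooted_forest (contract t s)" and s: "covering_subforest s t"
  shows "bij_betw (\<lambda>u. contract u s) {u. covering_subforest u t \<and> covering_subforest s u}
    {w. covering_subforest w (contract t s)}"
proof -
  have st: "sub_graph s t" using covering_imp_sub_graph[OF t s] .
  have Vs: "pverts s = pverts t" "parcs s \<subseteq> parcs t" using s covering_subforest_iff[OF t] by auto
  let ?b = "block s"
  let ?L = "{u. pverts u = pverts t \<and> parcs s \<subseteq> parcs u \<and> parcs u \<subseteq> parcs t}"
  have L: "{u. covering_subforest u t \<and> covering_subforest s u} = ?L"
  proof -
    have "covering_subforest s u \<longleftrightarrow> pverts s = pverts u \<and> parcs s \<subseteq> parcs u"
      if "covering_subforest u t" for u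
      using covering_subforest_iff sub_graph_forest[OF covering_imp_sub_graph[OF t that] t] by blast
    then show ?thesis using Vs covering_subforest_iff[OF t] by auto
  qed
  \<comment> \<open>membership of an arc in a covering subforest between \<^term>\<open>s\<close> and \<^term>\<open>t\<close> can be read off its image\<close>
  have lift: "(x, y) \<in> parcs u \<longleftrightarrow> (x, y) \<in> parcs s \<or> (?b x, ?b y) \<in> parcs (quot ?b u)"
    if "u \<in> ?L" "(x, y) \<in> parcs t" for u x y
  proof
    assume "(x, y) \<in> parcs u"
    then show "(x, y) \<in> parcs s \<or> (?b x, ?b y) \<in> parcs (quot ?b u)"
      using block_eq_arc_iff[OF t st that(2)] by (auto simp: parcs_quot)
  next
    assume "(x, y) \<in> parcs s \<or> (?b x, ?b y) \<in> parcs (quot ?b u)"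
    then show "(x, y) \<in> parcs u"
    proof
      assume "(?b x, ?b y) \<in> parcs (quot ?b u)"
      then obtain x' y' where xy': "?b x = ?b x'" "?b y = ?b y'" "(x', y') \<in> parcs u" "?b x' \<noteq> ?b y'"
        unfolding mem_parcs_quot by blast
      have "(x', y') \<in> parcs t" using xy'(3) that(1) by auto
      then have "x = x' \<and> y = y'"
        using arc_into_block_unique[OF t st that(2), of x' y'] xy' by simp
      then show "(x, y) \<in> parcs u" using xy'(3) by simp
    qed (use that in auto)
  qed
  have "bij_betw (quot ?b) ?L {w. covering_subforest w (quot ?b t)}"
  proof (rule bij_betw_imageI)
    show "inj_on (quot ?b) ?L"
    proof (rule inj_onI)
      fix u w assume uw: "u \<in> ?L" "w \<in> ?L" "quot ?b u = quot ?b w"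
      have "(x, y) \<in> parcs u \<longleftrightarrow> (x, y) \<in> parcs w" if "(x, y) \<in> parcs t" for x y
        unfolding lift[OF uw(1) that] lift[OF uw(2) that] uw(3) by (rule refl)
      moreover have "parcs u \<subseteq> parcs t" "parcs w \<subseteq> parcs t" using uw by auto
      ultimately have "parcs u = parcs w" by (intro equalityI subrelI) blast+
      then show "u = w" using uw by simp
    qed
    show "quot ?b ` ?L = {w. covering_subforest w (quot ?b t)}"
    proof (intro equalityI subsetI)
      fix w assume "w \<in> quot ?b ` ?L"
      then obtain u where u: "w = quot ?b u" "pverts u = pverts t" "parcs u \<subseteq> parcs t" by blast
      then have "parcs w \<subseteq> parcs (quot ?b t)" unfolding parcs_quot u(1) by blast
      then show "w \<in> {w. covering_subforest w (quot ?b t)}"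
        using u covering_subforest_iff[OF t'[unfolded contract_eq_quot]] by simp
    next
      fix w assume "w \<in> {w. covering_subforest w (quot ?b t)}"
      then have w: "pverts w = ?b ` pverts t" "parcs w \<subseteq> parcs (quot ?b t)"
        using t' unfolding contract_eq_quot by (auto simp: covering_subforest_iff)
      \<comment> \<open>the arcs of \<^term>\<open>w\<close>, lifted to \<^term>\<open>t\<close>, together with those contracted away\<close>
      define u where "u = \<lparr>pverts = pverts t,
        parcs = parcs s \<union> {(x, y) \<in> parcs t. (?b x, ?b y) \<in> parcs w}\<rparr>"
      have "parcs (quot ?b u) = parcs w"
      proof (intro equalityI subsetI)
        fix e assume "e \<in> parcs (quot ?b u)"
        then show "e \<in> parcs w"
          using block_eq_arc_iff[OF t st] Vs by (auto simp: parcs_quot u_def)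
      next
        fix e assume e: "e \<in> parcs w"
        then obtain x y where "e = (?b x, ?b y)" "(x, y) \<in> parcs t" "?b x \<noteq> ?b y"
          using subsetD[OF w(2) e] unfolding parcs_quot by blast
        then show "e \<in> parcs (quot ?b u)" using e by (auto simp: parcs_quot u_def)
      qed
      moreover have "pverts (quot ?b u) = pverts w" using w(1) by (simp add: u_def)
      ultimately have "w = quot ?b u" by simp
      moreover have "u \<in> ?L" using Vs by (auto simp: u_def)
      ultimately show "w \<in> quot ?b ` ?L" by (rule image_eqI)
    qed
  qed
  then show ?thesis by (simp only: L contract_eq_quot)
qed

text \<open>
  Linking two vertices through \<^term>\<open>u\<close> amounts to linking their \<^term>\<open>s\<close>-blocks in the
  contraction, since arcs inside a block of \<^term>\<open>s\<close> belong to \<^term>\<open>u\<close> anyway. Therefore contracting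
  in two steps makes the same identifications as contracting at once.
\<close>

lemma block_contract_iff:
  assumes s: "parcs s \<subseteq> pverts s \<times> pverts s" and u: "parcs u \<subseteq> pverts u \<times> pverts u"
    and sub: "parcs s \<subseteq> parcs u"
  shows "block (contract u s) (block s x) = block (contract u s) (block s y) \<longleftrightarrow>
    block u x = block u y"
proof -
  have wf: "parcs (contract u s) \<subseteq> pverts (contract u s) \<times> pverts (contract u s)"
    using u unfolding contract_eq_quot by (auto simp: parcs_quot)
  let ?Q = "parcs (contract u s)"
  have down: "(block s x, block s y) \<in> linked ?Q" if "(x, y) \<in> linked (parcs u)" for x y
    using that
  proof (induction rule: linked_induct)
    case refl
    then show ?case by (rule linked_refl)
  next
    case (forward y z)
    then have "(block s y, block s z) \<in> linked ?Q"
      by (cases "block s y = block s z")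
         (auto simp: linked_refl contract_eq_quot parcs_quot intro!: linked_arc)
    then show ?case using forward.IH linked_trans by metis
  next
    case (backward y z)
    then have "(block s z, block s y) \<in> linked ?Q"
      by (cases "block s y = block s z")
         (auto simp: linked_refl contract_eq_quot parcs_quot intro!: linked_arc)
    then show ?case using backward.IH linked_trans linked_sym by metis
  qed
  have same: "(x, y) \<in> linked (parcs u)" if "block s x = block s y" for x y
    using that linked_mono[OF sub] by (auto simp: block_eq_iff[OF s])
  have up: "\<forall>y. Y = block s y \<longrightarrow> (x, y) \<in> linked (parcs u)"
    if "(block s x, Y) \<in> linked ?Q" for Y
    using that
  proof (induction rule: linked_induct)
    case refl
    then show ?case using same by blast
  next
    case (forward Y Z)
    then obtain v w where "(v, w) \<in> parcs u" "Y = block s v" "Z = block s w"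
      by (auto simp: contract_eq_quot parcs_quot)
    then show ?case using forward.IH same linked_arc linked_trans by metis
  next
    case (backward Y Z)
    then obtain v w where "(w, v) \<in> parcs u" "Y = block s v" "Z = block s w"
      by (auto simp: contract_eq_quot parcs_quot)
    then show ?case using backward.IH same linked_arc linked_trans linked_sym by metis
  qed
  show ?thesis unfolding block_eq_iff[OF wf] block_eq_iff[OF u] using up down by blast
qed


section \<open>Prunings\<close>

text \<open>
  The subgraph induced on a set of vertices that contains with a vertex all its children; this is
  what lies above a cut, described without the cut.
\<close>

definition up_closed :: "'a pair_pre_digraph \<Rightarrow> 'a pair_pre_digraph \<Rightarrow> bool" where
  "up_closed s t \<longleftrightarrow> pverts s \<subseteq> pverts t \<and> parcs s = Restr (parcs t) (pverts s) \<and>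
     (\<forall>u v. (u, v) \<in> parcs t \<longrightarrow> u \<in> pverts s \<longrightarrow> v \<in> pverts s)"

lemma up_closed_sub_graph: "up_closed s t \<Longrightarrow> sub_graph s t"
  unfolding up_closed_def sub_graph_def by blast

lemma up_closedD: "up_closed s t \<Longrightarrow> (u, v) \<in> parcs t \<Longrightarrow> u \<in> pverts s \<Longrightarrow> v \<in> pverts s"
  unfolding up_closed_def by blast

lemma up_closed_verts: "up_closed s t \<Longrightarrow> pverts s \<subseteq> pverts t"
  and up_closed_arcs: "up_closed s t \<Longrightarrow> parcs s = Restr (parcs t) (pverts s)"
  unfolding up_closed_def by blast+

lemma mem_above_iff:
  assumes "parcs t \<subseteq> pverts t \<times> pverts t" "c \<subseteq> parcs t"
  shows "w \<in> above t c \<longleftrightarrow> (\<exists>u v. (u, v) \<in> c \<and> (v, w) \<in> (parcs t)\<^sup>*)"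
proof -
  have "v \<rightarrow>\<^sup>*\<^bsub>with_proj t\<^esub> w \<longleftrightarrow> (v, w) \<in> (parcs t)\<^sup>*" if uv: "(u, v) \<in> c" for u v
  proof (rule reachable_with_proj[OF assms(1)])
    show "v \<in> pverts t" using subsetD[OF assms(1) subsetD[OF assms(2) uv]] by simp
  qed
  then have "(\<exists>u v. (u, v) \<in> c \<and> v \<rightarrow>\<^sup>*\<^bsub>with_proj t\<^esub> w) \<longleftrightarrow>
      (\<exists>u v. (u, v) \<in> c \<and> (v, w) \<in> (parcs t)\<^sup>*)" by metis
  moreover have "w \<in> above t c \<longleftrightarrow> (\<exists>u v. (u, v) \<in> c \<and> v \<rightarrow>\<^sup>*\<^bsub>with_proj t\<^esub> w)"
    unfolding above_def by blast
  ultimately show ?thesis by (simp only:)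
qed

text \<open>
  A set of vertices closed under children is either everything, which is the total cut, or avoids
  the root. In the latter case the cut consists of the arcs that enter the set: a path from the root
  enters at most once because it cannot leave again, and each vertex of the set has such an
  arc below it on its path from the root.
\<close>

lemma pruning_iff_up_closed:
  assumes "rooted_tree t"
  shows "(\<exists>c. admissible_cut t c \<and> s = pruning t c) \<longleftrightarrow> up_closed s t"
proof -
  obtain r where r: "rooted_at t r" using assms unfolding rooted_tree_iff by blast
  then have wf: "parcs t \<subseteq> pverts t \<times> pverts t"
    and reach: "\<And>v. v \<in> pverts t \<Longrightarrow> (r, v) \<in> (parcs t)\<^sup>*" by (rule rooted_atD)+
  have up: "w \<in> S" if "(v, w) \<in> (parcs t)\<^sup>*" "v \<in> S" "\<And>x y. (x, y) \<in> parcs t \<Longrightarrow> x \<in> S \<Longrightarrow> y \<in> S"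
    for v w S
    using that by (induction rule: rtrancl_induct) blast+
  show ?thesis
  proof
    assume "\<exists>c. admissible_cut t c \<and> s = pruning t c"
    then obtain c where c: "admissible_cut t c" "s = pruning t c" by blast
    show "up_closed s t"
    proof (cases c)
      case Total_Cut
      then show ?thesis using c wf unfolding up_closed_def by auto
    next
      case (Edge_Cut d)
      then have d: "d \<subseteq> parcs t" using c by simp
      have "above t d \<subseteq> pverts t"
      proof
        fix w assume "w \<in> above t d"
        then obtain u v where "(u, v) \<in> d" "(v, w) \<in> (parcs t)\<^sup>*"
          using mem_above_iff[OF wf d] by blast
        then show "w \<in> pverts t" using d wf up[of v w "pverts t"] by blast
      qed
      moreover have "\<forall>x y. (x, y) \<in> parcs t \<longrightarrow> x \<in> above t d \<longrightarrow> y \<in> above t d"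
        unfolding mem_above_iff[OF wf d] by (meson rtrancl_into_rtrancl)
      ultimately show ?thesis
        unfolding up_closed_def c(2) Edge_Cut pruning.simps pair_pre_digraph.simps by blast
    qed
  next
    assume s: "up_closed s t"
    note closed = up_closedD[OF s]
    show "\<exists>c. admissible_cut t c \<and> s = pruning t c"
    proof (cases "r \<in> pverts s")
      case True
      have "w \<in> pverts s" if "w \<in> pverts t" for w
        by (rule up[OF reach[OF that] True closed])
      then have V: "pverts s = pverts t" using up_closed_verts[OF s] by blast
      then have "parcs s = parcs t" using up_closed_arcs[OF s] wf by auto
      then have "s = t" using V by simp
      then show ?thesis by (intro exI[of _ Total_Cut]) simp
    next
      case False
      define c where "c = {(u, v) \<in> parcs t. u \<notin> pverts s \<and> v \<in> pverts s}"
      have c: "c \<subseteq> parcs t" by (auto simp: c_def)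
      have "\<exists>u' v'. (u', v') \<in> c \<and> (v', w) \<in> (parcs t)\<^sup>*"
        if "(r, w) \<in> (parcs t)\<^sup>*" "w \<in> pverts s" for w
        using that
      proof (induction rule: rtrancl_induct)
        case (step y z)
        show ?case
        proof (cases "y \<in> pverts s")
          case True
          then show ?thesis using step.IH step.hyps(2) by (meson rtrancl_into_rtrancl)
        next
          case False
          then have "(y, z) \<in> c" using step.hyps step.prems by (simp add: c_def)
          then show ?thesis by blast
        qed
      qed (use False in simp)
      then have "pverts s \<subseteq> above t c"
        using reach up_closed_verts[OF s] mem_above_iff[OF wf c] by blast
      moreover have "above t c \<subseteq> pverts s"
      proof
        fix w assume "w \<in> above t c"
        then obtain u v where "(u, v) \<in> c" "(v, w) \<in> (parcs t)\<^sup>*"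
          using mem_above_iff[OF wf c] by blast
        then show "w \<in> pverts s" using up[of v w "pverts s"] closed by (simp add: c_def)
      qed
      ultimately have ab: "above t c = pverts s" by blast
      \<comment> \<open>a walk that starts in \<^term>\<open>s\<close> stays there\<close>
      have inside: "set p \<inter> c = {}" if "pcas x p y" "set p \<subseteq> parcs t" "x \<in> pverts s" for x p y
        using that
      proof (induction p arbitrary: x)
        case (Cons e p)
        then have "fst e \<in> pverts s" "(fst e, snd e) \<in> parcs t" by auto
        then have "snd e \<in> pverts s" "e \<notin> c"
          using closed[of "fst e" "snd e"] by (auto simp: c_def)
        then show ?case using Cons.IH[of "snd e"] Cons.prems by auto
      qed simp
      have single: "\<exists>e. set p \<inter> c \<subseteq> {e}" if "pcas x p y" "set p \<subseteq> parcs t" for x p y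
        using that
      proof (induction p arbitrary: x)
        case (Cons e p)
        show ?case
        proof (cases "snd e \<in> pverts s")
          case True
          then have "set p \<inter> c = {}" using inside[of "snd e" p y] Cons.prems by simp
          then have "set (e # p) \<inter> c \<subseteq> {e}" by auto
          then show ?thesis by blast
        next
          case False
          then have "e \<notin> c" by (auto simp: c_def)
          then have "set (e # p) \<inter> c = set p \<inter> c" by auto
          then show ?thesis using Cons.IH[of "snd e"] Cons.prems by simp
        qed
      qed simp
      have "card (set p \<inter> c) \<le> 1" if "pre_digraph.awalk (with_proj t) x p y" for x p y
      proof -
        have "pcas x p y" "set p \<subseteq> parcs t"
          using that unfolding pre_digraph.awalk_def cas_with_proj_eq with_proj_simps by auto
        then obtain e where "set p \<inter> c \<subseteq> {e}" using single by blast
        then show ?thesis using card_mono[of "{e}" "set p \<inter> c"] by simp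
      qed
      then have "admissible_cut t (Edge_Cut c)" using c unfolding admissible_cut.simps by blast
      moreover have "s = pruning t (Edge_Cut c)" using up_closed_arcs[OF s] by (simp add: ab)
      ultimately show ?thesis by blast
    qed
  qed
qed

text \<open>
  Since \<^term>\<open>s'\<close> covers \<^term>\<open>s\<close>, a block that meets \<^term>\<open>s\<close> is contained in it.
\<close>

lemma up_closed_contract:
  assumes s: "up_closed s t" and s': "pverts s' = pverts s" "parcs s' \<subseteq> pverts s' \<times> pverts s'"
  shows "up_closed (contract s s') (contract t s')"
proof -
  let ?b = "block s'"
  \<comment> \<open>\<^term>\<open>s\<close> is saturated with respect to the blocks of \<^term>\<open>s'\<close>\<close>
  have sat: "v \<in> pverts s" if "?b v \<in> ?b ` pverts s" for v
  proof -
    obtain u where "u \<in> pverts s" "?b u = ?b v" using \<open>?b v \<in> ?b ` pverts s\<close> by fastforce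
    then show ?thesis using linked_in_verts[OF s'(2)] s'(1) block_eq_iff[OF s'(2)] by blast
  qed
  have "parcs (quot ?b s) = Restr (parcs (quot ?b t)) (?b ` pverts s)"
  proof (intro equalityI subrelI)
    fix x y assume "(x, y) \<in> parcs (quot ?b s)"
    then obtain u v where uv: "(u, v) \<in> parcs s" "x = ?b u" "y = ?b v" "?b u \<noteq> ?b v"
      unfolding mem_parcs_quot by blast
    then have "(u, v) \<in> parcs t" "u \<in> pverts s" "v \<in> pverts s" using up_closed_arcs[OF s] by auto
    then show "(x, y) \<in> Restr (parcs (quot ?b t)) (?b ` pverts s)"
      using uv unfolding parcs_quot by blast
  next
    fix x y assume xy: "(x, y) \<in> Restr (parcs (quot ?b t)) (?b ` pverts s)"
    then obtain u v where uv: "(u, v) \<in> parcs t" "x = ?b u" "y = ?b v" "?b u \<noteq> ?b v"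
      unfolding parcs_quot by blast
    then have "u \<in> pverts s" "v \<in> pverts s" using xy by (auto intro: sat)
    then show "(x, y) \<in> parcs (quot ?b s)"
      using uv up_closed_arcs[OF s] unfolding parcs_quot by blast
  qed
  moreover have "y \<in> ?b ` pverts s" if "(x, y) \<in> parcs (quot ?b t)" "x \<in> ?b ` pverts s" for x y
  proof -
    obtain u v where uv: "(u, v) \<in> parcs t" "x = ?b u" "y = ?b v"
      using \<open>(x, y) \<in> _\<close> unfolding mem_parcs_quot by blast
    then have "u \<in> pverts s" using \<open>x \<in> _\<close> by (auto intro: sat)
    then show ?thesis using up_closedD[OF s uv(1)] uv(3) by blast
  qed
  moreover have "?b ` pverts s \<subseteq> ?b ` pverts t" using up_closed_verts[OF s] by blast
  ultimately show ?thesis unfolding up_closed_def contract_eq_quot pverts_quot by blast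
qed

section \<open>Couples up to isomorphism\<close>

lemma map_graph_simps [simp]:
  "pverts (map_graph f t) = f ` pverts t" "parcs (map_graph f t) = map_prod f f ` parcs t"
  by (simp_all add: map_graph_def)

lemma graph_eqI: "pverts s = pverts t \<Longrightarrow> parcs s = parcs t \<Longrightarrow> s = (t :: 'a pair_pre_digraph)"
  by simp

lemma map_graph_comp: "map_graph g (map_graph f t) = map_graph (g \<circ> f) t"
  by (rule graph_eqI) (auto simp: image_image map_prod_def split_beta)

text \<open>
  Only the values on vertices matter; this is how a map is cancelled by an inverse that is defined
  on its image only.
\<close>

lemma map_graph_ident:
  assumes "\<And>x. x \<in> pverts t \<Longrightarrow> f x = x" "parcs t \<subseteq> pverts t \<times> pverts t"
  shows "map_graph f t = t"
proof (rule graph_eqI)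
  have "map_prod f f e = e" if "e \<in> parcs t" for e
    using subsetD[OF assms(2) that] assms(1) by (cases e) simp
  then show "parcs (map_graph f t) = parcs t" by simp
qed (use assms(1) in simp)

lemma map_prod_imageI: "(x, y) \<in> A \<Longrightarrow> (f x, f y) \<in> map_prod f f ` A"
  using imageI[of "(x, y)" A "map_prod f f"] by simp

lemma map_prod_imageE:
  assumes "(x, y) \<in> map_prod f f ` A"
  obtains u v where "(u, v) \<in> A" "x = f u" "y = f v"
  using assms by auto

lemma rooted_at_map_graph:
  assumes t: "rooted_at t r" and f: "inj_on f (pverts t)"
  shows "rooted_at (map_graph f t) (f r)"
proof -
  note D = rooted_atD[OF t]
  let ?E = "map_prod f f ` parcs t"
  have V: "u \<in> pverts t" "v \<in> pverts t" if "(u, v) \<in> parcs t" for u v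
    using subsetD[OF D(2) that] by simp_all
  have noin: "(x, f r) \<notin> ?E" for x
  proof
    assume "(x, f r) \<in> ?E"
    then obtain u v where uv: "(u, v) \<in> parcs t" "f r = f v" by (rule map_prod_imageE)
    then show False using inj_onD[OF f uv(2) D(3)] V D(4) by simp
  qed
  have uniq: "x = x'" if xy: "(x, y) \<in> ?E" "(x', y) \<in> ?E" for x x' y
  proof -
    obtain u v where uv: "(u, v) \<in> parcs t" "x = f u" "y = f v"
      using xy(1) by (rule map_prod_imageE)
    obtain u' v' where uv': "(u', v') \<in> parcs t" "x' = f u'" "y = f v'"
      using xy(2) by (rule map_prod_imageE)
    have "v = v'" using inj_onD[OF f, of v v'] V(2)[OF uv(1)] V(2)[OF uv'(1)] uv(3) uv'(3) by simp
    then show ?thesis using D(5)[of u v u'] uv(1,2) uv'(1,2) by simp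
  qed
  have reach: "(f r, f v) \<in> ?E\<^sup>*" if "v \<in> pverts t" for v
    using D(6)[OF that]
  proof (induction rule: rtrancl_induct)
    case (step y z)
    from step.hyps(2) have "(f y, f z) \<in> ?E" by (rule map_prod_imageI)
    then show ?case using step.IH by (rule rtrancl_into_rtrancl[rotated])
  qed simp
  have wf: "?E \<subseteq> f ` pverts t \<times> f ` pverts t" using D(2) by auto
  show ?thesis
    unfolding rooted_at_def map_graph_simps
  proof (intro conjI allI impI ballI)
    fix x assume "x \<in> f ` pverts t"
    then obtain v where "v \<in> pverts t" "x = f v" by (rule imageE)
    then show "(f r, x) \<in> ?E\<^sup>*" using reach[of v] by simp
  next
    show "finite (f ` pverts t)" using D(1) by (rule finite_imageI)
    show "f r \<in> f ` pverts t" using D(3) by (rule imageI)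
    show "?E \<subseteq> f ` pverts t \<times> f ` pverts t" by (rule wf)
    show "(x, f r) \<notin> ?E" for x by (rule noin)
    show "x = x'" if "(x, y) \<in> ?E" "(x', y) \<in> ?E" for x x' y using that by (rule uniq)
  qed
qed

lemma rooted_tree_map_graph:
  "rooted_tree t \<Longrightarrow> inj_on f (pverts t) \<Longrightarrow> rooted_tree (map_graph f t)"
  by (elim rooted_treeE) (rule rooted_at_imp_tree, rule rooted_at_map_graph)

lemma rooted_tree_imp_forest: "rooted_tree t \<Longrightarrow> rooted_forest t"
  by (elim rooted_treeE) (rule rooted_at_imp_forest)

lemma sub_graph_map_graph: "sub_graph s t \<Longrightarrow> sub_graph (map_graph f s) (map_graph f t)"
  unfolding sub_graph_def map_graph_simps
  by (intro conjI) (rule image_mono, simp, rule image_mono, simp, auto)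

text \<open>
  The couples that span the larger space, with the subforest condition in its graph form.
\<close>

definition valid_couple :: "'a pair_pre_digraph \<Rightarrow> 'a pair_pre_digraph \<Rightarrow> bool" where
  "valid_couple t s \<longleftrightarrow> rooted_tree t \<and> sub_graph s t"

lemma valid_couple_iff: "valid_couple t s \<longleftrightarrow> rooted_tree t \<and> subforest s t"
  unfolding valid_couple_def using subforest_iff rooted_tree_imp_forest by blast

lemma valid_couple_forest: "valid_couple t s \<Longrightarrow> rooted_forest t" "valid_couple t s \<Longrightarrow> rooted_forest s"
  unfolding valid_couple_def using rooted_tree_imp_forest sub_graph_forest by blast+

lemma valid_couple_wf:
  assumes "valid_couple t s"
  shows "parcs t \<subseteq> pverts t \<times> pverts t" "parcs s \<subseteq> pverts s \<times> pverts s" "pverts s \<subseteq> pverts t"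
    "parcs s \<subseteq> pverts t \<times> pverts t" "finite (pverts t)"
  using assms valid_couple_forest(1)[OF assms]
  unfolding valid_couple_def sub_graph_def rooted_forest_def by blast+

lemma valid_couple_map_graph:
  "valid_couple t s \<Longrightarrow> inj_on f (pverts t) \<Longrightarrow> valid_couple (map_graph f t) (map_graph f s)"
  by (simp add: valid_couple_def rooted_tree_map_graph sub_graph_map_graph)

lemma couple_iso_trans:
  assumes "couple_iso p q" "couple_iso q r"
  shows "couple_iso p r"
proof -
  obtain f g where f: "inj_on f (pverts (fst p))" "q = (map_graph f (fst p), map_graph f (snd p))"
    and g: "inj_on g (pverts (fst q))" "r = (map_graph g (fst q), map_graph g (snd q))"
    using assms unfolding couple_iso_def by blast
  show ?thesis unfolding couple_iso_def
  proof (intro exI conjI)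
    show "inj_on (g \<circ> f) (pverts (fst p))" using f g(1) by (simp add: comp_inj_on)
    show "r = (map_graph (g \<circ> f) (fst p), map_graph (g \<circ> f) (snd p))"
      using f g(2) by (simp add: map_graph_comp)
  qed
qed

lemma couple_iso_sym:
  assumes iso: "couple_iso (t, s) q" and ok: "valid_couple t s"
  shows "couple_iso q (t, s)"
proof -
  obtain f where f: "inj_on f (pverts t)" "q = (map_graph f t, map_graph f s)"
    using iso unfolding couple_iso_def by auto
  let ?g = "inv_into (pverts t) f"
  have g: "(?g \<circ> f) x = x" if "x \<in> pverts t" for x using f(1) that by simp
  show ?thesis unfolding couple_iso_def
  proof (intro exI conjI)
    show "inj_on ?g (pverts (fst q))" using f(2) by (simp add: inj_on_inv_into)
    have "map_graph (?g \<circ> f) t = t"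
      by (rule map_graph_ident[OF g valid_couple_wf(1)[OF ok]])
    moreover have "map_graph (?g \<circ> f) s = s"
      by (rule map_graph_ident[OF g valid_couple_wf(2)[OF ok]]) (use valid_couple_wf(3)[OF ok] in blast)
    ultimately show "(t, s) = (map_graph ?g (fst q), map_graph ?g (snd q))"
      using f(2) by (simp add: map_graph_comp)
  qed
qed

lemma couple_iso_map_graph:
  "inj_on f (pverts t) \<Longrightarrow> couple_iso (t, s) (map_graph f t, map_graph f s)"
  unfolding couple_iso_def by (intro exI[of _ f]) simp

lemma iso_class_eqI:
  assumes "couple_iso (t, s) q" "valid_couple t s"
  shows "iso_class (t, s) = iso_class q"
proof (intro equalityI subsetI)
  fix x assume "x \<in> iso_class (t, s)"
  then have "couple_iso (t, s) x" by (simp add: iso_class_def)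
  then show "x \<in> iso_class q"
    using couple_iso_trans[OF couple_iso_sym[OF assms]] by (simp add: iso_class_def)
next
  fix x assume "x \<in> iso_class q"
  then have "couple_iso q x" by (simp add: iso_class_def)
  then show "x \<in> iso_class (t, s)"
    using couple_iso_trans[OF assms(1)] by (simp add: iso_class_def)
qed

lemma couple_of_eqI:
  "couple_iso (t, s) (t', s') \<Longrightarrow> valid_couple t s \<Longrightarrow> couple_of t s = couple_of t' s'"
  unfolding couple_of_def by (rule arg_cong[OF iso_class_eqI])

lemma nat_numbering:
  assumes "valid_couple t s"
  obtains f :: "'a \<Rightarrow> nat" where "inj_on f (pverts (t :: 'a pair_pre_digraph))"
  using finite_imp_inj_to_nat_seg[OF valid_couple_wf(5)[OF assms]] by auto

text \<open>
  Isomorphism classes consist of graphs on natural numbers, so that this copy is a member of the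
  class.
\<close>

lemma nat_copy:
  assumes "valid_couple t s"
  obtains t0 s0 :: "nat pair_pre_digraph" where "couple_iso (t, s) (t0, s0)" "valid_couple t0 s0"
proof -
  obtain f :: "_ \<Rightarrow> nat" where f: "inj_on f (pverts t)" using assms by (rule nat_numbering)
  show ?thesis by (rule that[OF couple_iso_map_graph[OF f] valid_couple_map_graph[OF assms f]])
qed

text \<open>
  The type of couples is carved out of classes of graphs on natural numbers; a copy on natural numbers
  shows that couples over any vertex type land in it.
\<close>

lemma Rep_couple_of:
  assumes "valid_couple t s"
  shows "Rep_couple (couple_of t s) = iso_class (t, s)"
proof -
  obtain t0 s0 :: "nat pair_pre_digraph" where iso: "couple_iso (t, s) (t0, s0)" and "valid_couple t0 s0"
    using nat_copy[OF assms] .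
  then have "rooted_tree t0 \<and> subforest s0 t0" by (simp add: valid_couple_iff)
  then have "iso_class (t, s) \<in> {iso_class (t, s) | (t :: nat pair_pre_digraph) s. rooted_tree t \<and> subforest s t}"
    unfolding iso_class_eqI[OF iso assms] by blast
  then show ?thesis unfolding couple_of_def by (rule Abs_couple_inverse)
qed

lemma couple_iso_couple_rep:
  assumes "valid_couple t s"
  shows "couple_iso (t, s) (couple_rep (couple_of t s))"
proof -
  obtain t0 s0 :: "nat pair_pre_digraph" where "couple_iso (t, s) (t0, s0)"
    using nat_copy[OF assms] .
  then have "(t0, s0) \<in> Rep_couple (couple_of t s)"
    unfolding Rep_couple_of[OF assms] by (simp add: iso_class_def)
  then have "couple_rep (couple_of t s) \<in> Rep_couple (couple_of t s)"
    unfolding couple_rep_def by (rule someI)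
  then show ?thesis unfolding Rep_couple_of[OF assms] by (simp add: iso_class_def)
qed

lemma couple_cases:
  obtains t s :: "nat pair_pre_digraph" where "valid_couple t s" "c = couple_of t s"
proof -
  obtain t s :: "nat pair_pre_digraph" where "Rep_couple c = iso_class (t, s)" "rooted_tree t" "subforest s t"
    using Rep_couple[of c] by blast
  then have "valid_couple t s" "c = couple_of t s"
    unfolding valid_couple_iff couple_of_def by (metis Rep_couple_inverse)+
  then show ?thesis by (rule that)
qed

lemma map_graph_quot:
  assumes h: "\<And>x. x \<in> V \<Longrightarrow> h (f x) = g x"
    and ker: "\<And>x y. x \<in> V \<Longrightarrow> y \<in> V \<Longrightarrow> f x = f y \<longleftrightarrow> g x = g y"
    and u: "pverts u \<subseteq> V" "parcs u \<subseteq> V \<times> V"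
  shows "map_graph h (quot f u) = quot g u"
proof (rule graph_eqI)
  show "pverts (map_graph h (quot f u)) = pverts (quot g u)"
    using h u(1) by (simp add: image_image subset_iff)
  have "(x, y) \<in> map_prod h h ` parcs (quot f u) \<longleftrightarrow> (x, y) \<in> parcs (quot g u)" for x y
  proof
    assume "(x, y) \<in> map_prod h h ` parcs (quot f u)"
    then obtain a b where "(a, b) \<in> parcs u" "x = h (f a)" "y = h (f b)" "f a \<noteq> f b"
      unfolding parcs_quot by auto
    moreover from this have "a \<in> V" "b \<in> V" using u(2) by auto
    ultimately show "(x, y) \<in> parcs (quot g u)"
      unfolding mem_parcs_quot using h ker by metis
  next
    assume "(x, y) \<in> parcs (quot g u)"
    then obtain a b where ab: "(a, b) \<in> parcs u" "x = g a" "y = g b" "g a \<noteq> g b"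
      unfolding mem_parcs_quot by blast
    then have V: "a \<in> V" "b \<in> V" using u(2) by auto
    then have "(f a, f b) \<in> parcs (quot f u)" unfolding mem_parcs_quot using ab ker by metis
    then have "map_prod h h (f a, f b) \<in> map_prod h h ` parcs (quot f u)" by (rule imageI)
    then show "(x, y) \<in> map_prod h h ` parcs (quot f u)" using V h ab by simp
  qed
  then show "parcs (map_graph h (quot f u)) = parcs (quot g u)" by auto
qed

text \<open>
  Up to isomorphism a quotient depends only on which vertices are identified. All comparisons of
  contractions reduce to comparing such kernels.
\<close>

lemma couple_iso_quot:
  assumes ker: "\<And>x y. x \<in> pverts t \<Longrightarrow> y \<in> pverts t \<Longrightarrow> f x = f y \<longleftrightarrow> g x = g y"
    and ok: "valid_couple t s"
  shows "couple_iso (quot f t, quot f s) (quot g t, quot g s)"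
proof -
  let ?V = "pverts t"
  define h where "h = g \<circ> inv_into ?V f"
  have h: "h (f x) = g x" if "x \<in> ?V" for x
  proof -
    have "inv_into ?V f (f x) \<in> ?V" "f (inv_into ?V f (f x)) = f x"
      using that by (auto intro: inv_into_into f_inv_into_f)
    then show ?thesis unfolding h_def o_def using ker that by metis
  qed
  have "inj_on h (f ` ?V)"
    using h ker by (auto intro!: inj_onI)
  moreover have "map_graph h (quot f u) = quot g u" if "pverts u \<subseteq> ?V" "parcs u \<subseteq> ?V \<times> ?V" for u
    using map_graph_quot[of ?V h f g u] h ker that by blast
  ultimately show ?thesis
    unfolding couple_iso_def using valid_couple_wf[OF ok] by (intro exI[of _ h]) simp
qed

text \<open>
  No arc is lost as a loop, since a graph without cycles has none to begin with.
\<close>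

lemma quot_inj_eq_map_graph:
  assumes f: "inj_on f V" and u: "parcs u \<subseteq> V \<times> V" and ac: "acyclic (parcs u)"
  shows "quot f u = map_graph f u"
proof (rule graph_eqI)
  have "f a \<noteq> f b" if ab: "(a, b) \<in> parcs u" for a b
  proof
    assume "f a = f b"
    then have "a = b" using f u ab by (auto dest: inj_onD)
    then show False using ac ab by (auto simp: acyclic_def)
  qed
  then have "(x, y) \<in> parcs (quot f u) \<longleftrightarrow> (x, y) \<in> map_prod f f ` parcs u" for x y
    unfolding mem_parcs_quot by (auto simp: map_prod_def image_iff Bex_def)
  then show "parcs (quot f u) = parcs (map_graph f u)" by auto
qed simp

lemma couple_of_map_graph:
  "valid_couple t s \<Longrightarrow> inj_on f (pverts t) \<Longrightarrow> couple_of (map_graph f t) (map_graph f s) = couple_of t s"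
  by (rule couple_of_eqI[symmetric, OF couple_iso_map_graph])

lemma linked_map_prod:
  assumes f: "inj_on f V" and A: "A \<subseteq> V \<times> V" and V: "x \<in> V" "y \<in> V"
  shows "(f x, f y) \<in> linked (map_prod f f ` A) \<longleftrightarrow> (x, y) \<in> linked A"
proof
  assume "(x, y) \<in> linked A"
  then show "(f x, f y) \<in> linked (map_prod f f ` A)"
  proof (induction rule: linked_induct)
    case (forward y z)
    then have "(f y, f z) \<in> map_prod f f ` A" by (intro map_prod_imageI)
    then show ?case using forward.IH by (meson linked_arc linked_trans)
  next
    case (backward y z)
    then have "(f z, f y) \<in> map_prod f f ` A" by (intro map_prod_imageI)
    then show ?case using backward.IH by (meson linked_arc linked_sym linked_trans)
  qed (rule linked_refl)
next
  have "\<exists>z \<in> V. Z = f z \<and> (x, z) \<in> linked A" if "(f x, Z) \<in> linked (map_prod f f ` A)" for Z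
    using that
  proof (induction rule: linked_induct)
    case refl
    show ?case using V(1) linked_refl[of x A] by (intro bexI[of _ x]) simp_all
  next
    case (forward Y Z)
    obtain y where y: "y \<in> V" "Y = f y \<and> (x, y) \<in> linked A"
      using forward.IH by (rule bexE)
    obtain y' z where z: "(y', z) \<in> A" "Y = f y'" "Z = f z"
      using forward.hyps(2) by (rule map_prod_imageE)
    have V': "y' \<in> V" "z \<in> V" using subsetD[OF A z(1)] by simp_all
    then have "y' = y" using inj_onD[OF f, of y' y] y z by simp
    then have "(x, z) \<in> linked A" using linked_trans[OF conjunct2[OF y(2)] linked_arc] z(1) by simp
    then show ?case using V'(2) z(3) by (intro bexI[of _ z] conjI)
  next
    case (backward Y Z)
    obtain y where y: "y \<in> V" "Y = f y \<and> (x, y) \<in> linked A"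
      using backward.IH by (rule bexE)
    obtain z y' where z: "(z, y') \<in> A" "Z = f z" "Y = f y'"
      using backward.hyps(2) by (rule map_prod_imageE)
    have V': "z \<in> V" "y' \<in> V" using subsetD[OF A z(1)] by simp_all
    then have "y' = y" using inj_onD[OF f, of y' y] y z by simp
    then have "(x, z) \<in> linked A" using linked_trans[OF conjunct2[OF y(2)] linked_sym[OF linked_arc]] z(1) by simp
    then show ?case using V'(1) z(2) by (intro bexI[of _ z] conjI)
  qed
  moreover assume "(f x, f y) \<in> linked (map_prod f f ` A)"
  ultimately have "\<exists>z \<in> V. f y = f z \<and> (x, z) \<in> linked A" .
  then obtain z where "z \<in> V" "f y = f z \<and> (x, z) \<in> linked A" by (rule bexE)
  then show "(x, y) \<in> linked A" using inj_onD[OF f, of y z] V(2) by simp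
qed

lemma valid_couple_contract:
  assumes ok: "valid_couple t s" and s': "covering_subforest s' s"
  shows "valid_couple t s'" "valid_couple (contract t s') (contract s s')"
proof -
  have sub: "sub_graph s' s" using covering_imp_sub_graph[OF valid_couple_forest(2)[OF ok] s'] .
  then have sub': "sub_graph s' t" using ok sub_graph_trans unfolding valid_couple_def by blast
  then show "valid_couple t s'" using ok unfolding valid_couple_def by blast
  have "rooted_tree t" using ok unfolding valid_couple_def by blast
  then have "rooted_tree (contract t s')"
    by (elim rooted_treeE) (rule rooted_at_imp_tree, rule rooted_at_contract[OF _ sub'])
  then show "valid_couple (contract t s') (contract s s')"
    using ok contract_sub_graph unfolding valid_couple_def by blast
qed

text \<open>
  Both contractions are quotients of the same tree, and relabelling does not change which vertices
  are linked.
\<close>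

lemma couple_of_contract_map_graph:
  assumes ok: "valid_couple t s" and s': "covering_subforest s' s" and f: "inj_on f (pverts t)"
  shows "couple_of (contract (map_graph f t) (map_graph f s')) (contract (map_graph f s) (map_graph f s')) =
    couple_of (contract t s') (contract s s')"
proof -
  note ok' = valid_couple_contract(1)[OF ok s']
  let ?b = "block (map_graph f s') \<circ> f"
  have ac: "acyclic (parcs t)" "acyclic (parcs s)"
    using valid_couple_forest[OF ok] unfolding rooted_forest_def by auto
  have "map_graph f t = quot f t" "map_graph f s = quot f s"
    using quot_inj_eq_map_graph[OF f] valid_couple_wf[OF ok] ac by auto
  then have eq: "contract (map_graph f t) (map_graph f s') = quot ?b t"
      "contract (map_graph f s) (map_graph f s') = quot ?b s"
    unfolding contract_eq_quot by (simp_all add: quot_quot)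
  have ker: "?b x = ?b y \<longleftrightarrow> block s' x = block s' y" if "x \<in> pverts t" "y \<in> pverts t" for x y
  proof -
    have "parcs (map_graph f s') \<subseteq> pverts (map_graph f s') \<times> pverts (map_graph f s')"
      using valid_couple_wf(2)[OF ok'] by auto
    then show ?thesis
      using linked_map_prod[OF f valid_couple_wf(4)[OF ok'] that]
      by (simp add: block_eq_iff valid_couple_wf(2)[OF ok'])
  qed
  have "couple_iso (contract t s', contract s s') (quot ?b t, quot ?b s)"
    unfolding contract_eq_quot by (rule couple_iso_quot[OF _ ok]) (simp only: ker)
  then show ?thesis
    unfolding eq by (rule couple_of_eqI[symmetric, OF _ valid_couple_contract(2)[OF ok s']])
qed

text \<open>
  Relabelling acts on sets of arcs by taking images, which is injective on subsets of
  \<^term>\<open>parcs s\<close>.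
\<close>

lemma bij_betw_map_graph_covering:
  assumes ok: "valid_couple t s" and f: "inj_on f (pverts t)"
  shows "bij_betw (map_graph (f :: 'a \<Rightarrow> 'b)) {u. covering_subforest u s}
    {u. covering_subforest u (map_graph f s)}"
proof -
  have forest: "rooted_forest s" "rooted_forest (map_graph f s)"
    using valid_couple_forest(2) ok valid_couple_map_graph[OF ok f] by blast+
  let ?L = "{u. pverts u = pverts s \<and> parcs u \<subseteq> parcs s}"
  have inj: "inj_on (map_prod f f) (parcs s)"
    using inj_on_subset[OF map_prod_inj_on[OF f f] valid_couple_wf(4)[OF ok]] .
  have "bij_betw (map_graph f) ?L {w. pverts w = f ` pverts s \<and> parcs w \<subseteq> map_prod f f ` parcs s}"
  proof (rule bij_betw_imageI)
    show "inj_on (map_graph f) ?L"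
    proof (rule inj_onI)
      fix u w assume uw: "u \<in> ?L" "w \<in> ?L" "map_graph f u = map_graph f w"
      then have "map_prod f f ` parcs u = map_prod f f ` parcs w" by (metis map_graph_simps(2))
      then have "parcs u = parcs w" using inj_on_image_eq_iff[OF inj] uw by blast
      then show "u = w" using uw by (intro graph_eqI) auto
    qed
    show "map_graph f ` ?L = {w. pverts w = f ` pverts s \<and> parcs w \<subseteq> map_prod f f ` parcs s}"
    proof (intro equalityI subsetI)
      fix w :: "'b pair_pre_digraph"
      assume "w \<in> {w. pverts w = f ` pverts s \<and> parcs w \<subseteq> map_prod f f ` parcs s}"
      then obtain A where A: "A \<subseteq> parcs s" "parcs w = map_prod f f ` A" "pverts w = f ` pverts s"
        by (auto simp: subset_image_iff)
      then have "w = map_graph f \<lparr>pverts = pverts s, parcs = A\<rparr>" by (intro graph_eqI) auto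
      then show "w \<in> map_graph f ` ?L" using A(1) by (rule_tac image_eqI) auto
    qed (auto intro!: map_prod_imageI)
  qed
  then show ?thesis by (simp add: covering_subforest_iff[OF forest(1)] covering_subforest_iff[OF forest(2)])
qed

text \<open>
  The type of cut couples only mentions trees on natural numbers. Being closed under children is
  transported along a numbering of the vertices, and yields a cut of the numbered tree.
\<close>

lemma Rep_cut_couple_of:
  assumes t: "rooted_tree t" and s: "up_closed s t"
  shows "Rep_cut_couple (cut_couple_of t s) = couple_of t s"
proof -
  have ok: "valid_couple t s" using t up_closed_sub_graph[OF s] by (simp add: valid_couple_def)
  obtain f :: "_ \<Rightarrow> nat" where f: "inj_on f (pverts t)" using ok by (rule nat_numbering)
  have mem: "x \<in> pverts s" if fx: "f x \<in> f ` pverts s" and x: "x \<in> pverts t" for x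
  proof -
    from fx obtain y where y: "f x = f y" "y \<in> pverts s" by (rule imageE)
    have "x = y"
      by (rule inj_onD[OF f y(1) x subsetD[OF valid_couple_wf(3)[OF ok] y(2)]])
    then show ?thesis using y(2) by simp
  qed
  have arc: "u \<in> pverts t" "v \<in> pverts t" if "(u, v) \<in> parcs t" for u v
    using subsetD[OF valid_couple_wf(1)[OF ok] that] by simp_all
  have "parcs (map_graph f s) = Restr (parcs (map_graph f t)) (pverts (map_graph f s))"
  proof (intro equalityI subrelI)
    fix x y assume xy: "(x, y) \<in> Restr (parcs (map_graph f t)) (pverts (map_graph f s))"
    then have "(x, y) \<in> map_prod f f ` parcs t" by simp
    then obtain u v where uv: "(u, v) \<in> parcs t" "x = f u" "y = f v" by (rule map_prod_imageE)
    have "u \<in> pverts s" "v \<in> pverts s"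
      using xy uv arc[OF uv(1)] by (auto intro: mem)
    then have "(u, v) \<in> parcs s" using uv up_closed_arcs[OF s] by blast
    then show "(x, y) \<in> parcs (map_graph f s)" using uv map_prod_imageI by simp
  qed (use up_closed_arcs[OF s] in auto)
  moreover have "\<forall>x y. (x, y) \<in> parcs (map_graph f t) \<longrightarrow> x \<in> pverts (map_graph f s) \<longrightarrow>
      y \<in> pverts (map_graph f s)"
  proof (intro allI impI)
    fix x y assume "(x, y) \<in> parcs (map_graph f t)" and x: "x \<in> pverts (map_graph f s)"
    then have "(x, y) \<in> map_prod f f ` parcs t" by simp
    then obtain u v where uv: "(u, v) \<in> parcs t" "x = f u" "y = f v" by (rule map_prod_imageE)
    have "u \<in> pverts s" using x uv arc[OF uv(1)] by (auto intro: mem)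
    then show "y \<in> pverts (map_graph f s)" using uv(3) up_closedD[OF s uv(1)] by simp
  qed
  moreover have "pverts (map_graph f s) \<subseteq> pverts (map_graph f t)" using up_closed_verts[OF s] by auto
  ultimately have "up_closed (map_graph f s) (map_graph f t)" unfolding up_closed_def by blast
  moreover have t': "rooted_tree (map_graph f t)" using t f by (rule rooted_tree_map_graph)
  ultimately obtain c where "admissible_cut (map_graph f t) c" "map_graph f s = pruning (map_graph f t) c"
    using pruning_iff_up_closed by blast
  moreover have "couple_of t s = couple_of (map_graph f t) (map_graph f s)"
    using couple_of_map_graph[OF ok f] ..
  ultimately have "couple_of t s \<in>
      {couple_of t (pruning t c) | (t :: nat pair_pre_digraph) c. rooted_tree t \<and> admissible_cut t c}"
    using t' by (metis (mono_tags, lifting) mem_Collect_eq)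
  then show ?thesis unfolding cut_couple_of_def by (rule Abs_cut_couple_inverse)
qed

lemma cut_couple_cases:
  obtains t s :: "nat pair_pre_digraph" where "rooted_tree t" "up_closed s t" "c = cut_couple_of t s"
proof -
  obtain t d where "Rep_cut_couple c = couple_of t (pruning t d)"
      and td: "rooted_tree (t :: nat pair_pre_digraph)" "admissible_cut t d"
    using Rep_cut_couple[of c] by blast
  then have "c = cut_couple_of t (pruning t d)"
    unfolding cut_couple_of_def by (metis Rep_cut_couple_inverse)
  moreover have "up_closed (pruning t d) t" using pruning_iff_up_closed td by blast
  ultimately show ?thesis using that td(1) by blast
qed

section \<open>Algebra homomorphisms between monoid algebras\<close>

abbreviation lin :: "(('a \<Rightarrow>\<^sub>0 'k::field) \<Rightarrow> ('b \<Rightarrow>\<^sub>0 'k)) \<Rightarrow> bool" where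
  "lin F \<equiv> Vector_Spaces.linear scale scale F"

lemma lin_sum: "lin F \<Longrightarrow> F (sum f A) = (\<Sum>a \<in> A. F (f a))"
proof -
  assume "lin F"
  then interpret Vector_Spaces.linear scale scale F .
  show "F (sum f A) = (\<Sum>a \<in> A. F (f a))" by (rule sum)
qed

lemma lin_id: "lin (\<lambda>x :: 'a \<Rightarrow>\<^sub>0 'k::field. x)"
proof -
  interpret vector_space "scale :: 'k \<Rightarrow> ('a \<Rightarrow>\<^sub>0 'k) \<Rightarrow> _" by (rule vector_space_scale)
  show ?thesis by (rule linear_ident)
qed

lemma lin_comp: "lin F \<Longrightarrow> lin G \<Longrightarrow> lin (\<lambda>x. F (G x))"
  using Vector_Spaces.linear_compose[of scale scale G scale F] by (simp add: o_def)

lemma lin_tensor_left: "lin (\<lambda>x. x \<otimes>\<^sub>k y)" and lin_tensor_right: "lin (\<lambda>y. x \<otimes>\<^sub>k y)"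
  using bilinear_tensor unfolding bilinear_def by auto

lemma tensor_sum_left: "sum f A \<otimes>\<^sub>k y = (\<Sum>a \<in> A. f a \<otimes>\<^sub>k y)"
  by (rule lin_sum[OF lin_tensor_left])

lemma tensor_sum_right: "x \<otimes>\<^sub>k sum f A = (\<Sum>a \<in> A. x \<otimes>\<^sub>k f a)"
  by (rule lin_sum[OF lin_tensor_right])

lemma tensor_basis [simp]: "basis a \<otimes>\<^sub>k basis b = basis (a, b)"
  by (simp add: tensor_alt)

text \<open>
  Scaling is multiplication by a constant, so that it commutes with products.
\<close>

lemma scale_conv_times: "scale c x = Poly_Mapping.single 0 c * x"
  for x :: "'a::comm_monoid_add \<Rightarrow>\<^sub>0 'k::field"
  unfolding scale_def by (rule mult_map_scale_conv_mult)

lemma lin_times: "lin F \<Longrightarrow> lin (\<lambda>x. F x * y)"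
  for F :: "('b \<Rightarrow>\<^sub>0 'k::field) \<Rightarrow> ('a::comm_monoid_add \<Rightarrow>\<^sub>0 'k)"
proof -
  assume "lin F"
  then interpret F: Vector_Spaces.linear scale scale F .
  show "lin (\<lambda>x. F x * y)"
    by unfold_locales (simp_all add: F.add F.scale distrib_right scale_conv_times mult.assoc)
qed

lemma lin_times_left: "lin F \<Longrightarrow> lin (\<lambda>x. y * F x)"
  for F :: "('b \<Rightarrow>\<^sub>0 'k::field) \<Rightarrow> ('a::comm_monoid_add \<Rightarrow>\<^sub>0 'k)"
  using lin_times[of F y] by (simp add: mult.commute)

lemma lin_eqI:
  assumes "lin F" "lin G" "\<And>a. F (basis a) = G (basis a)"
  shows "F x = G x"
  using linear_ext_eqI[OF assms(1), of "\<lambda>a. G (basis a)"] linear_ext_eqI[OF assms(2), of "\<lambda>a. G (basis a)"] assms(3)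
  by simp

definition alg_hom ::
    "(('a::comm_monoid_add \<Rightarrow>\<^sub>0 'k::field) \<Rightarrow> ('b::comm_monoid_add \<Rightarrow>\<^sub>0 'k)) \<Rightarrow> bool" where
  "alg_hom F \<longleftrightarrow> lin F \<and> F 1 = 1 \<and> (\<forall>x y. F (x * y) = F x * F y)"

lemma basis_add: "basis (a + b) = basis a * basis b"
  by (simp add: mult_single)

lemma one_eq_basis: "1 = basis 0"
  by simp

text \<open>
  A homomorphism from the monoid of monomials into the multiplicative monoid of an algebra extends
  linearly to an algebra homomorphism.
\<close>

lemma alg_hom_linear_ext:
  fixes f :: "'a::comm_monoid_add \<Rightarrow> ('b::comm_monoid_add \<Rightarrow>\<^sub>0 'k::field)"
  assumes "f 0 = 1" "\<And>a b. f (a + b) = f a * f b"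
  shows "alg_hom (linear_ext f)"
proof -
  let ?F = "linear_ext f"
  note lin = linear_linear_ext[of f]
  have "?F (x * y) = ?F x * ?F y" for x y
  proof (rule lin_eqI[of "\<lambda>x. ?F (x * y)" "\<lambda>x. ?F x * ?F y"])
    show "lin (\<lambda>x. ?F (x * y))" by (rule lin_comp[OF lin lin_times[OF lin_id]])
    show "lin (\<lambda>x. ?F x * ?F y)" by (rule lin_times[OF lin])
    show "?F (basis a * y) = ?F (basis a) * ?F y" for a
    proof (rule lin_eqI[of "\<lambda>y. ?F (basis a * y)" "\<lambda>y. ?F (basis a) * ?F y"])
      show "lin (\<lambda>y. ?F (basis a * y))" by (rule lin_comp[OF lin lin_times_left[OF lin_id]])
      show "lin (\<lambda>y. ?F (basis a) * ?F y)" by (rule lin_times_left[OF lin])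
      show "?F (basis a * basis b) = ?F (basis a) * ?F (basis b)" for b
        by (simp add: assms(2) flip: basis_add)
    qed
  qed
  moreover have "?F 1 = 1" using assms(1) by (simp add: one_eq_basis del: single_one)
  ultimately show ?thesis using lin by (simp add: alg_hom_def)
qed

lemma alg_hom_id: "alg_hom id"
  using lin_id by (simp add: alg_hom_def id_def)

lemma alg_hom_comp: "alg_hom F \<Longrightarrow> alg_hom G \<Longrightarrow> alg_hom (F \<circ> G)"
  using lin_comp[of F G] by (simp add: alg_hom_def o_def)

text \<open>
  A monomial is a product of generators.
\<close>

lemma alg_hom_eqI:
  fixes F :: "('c, 'k::field) sym \<Rightarrow> ('b::comm_monoid_add \<Rightarrow>\<^sub>0 'k)"
  assumes F: "alg_hom F" and G: "alg_hom G"
    and gen: "\<And>c. F (generator c) = G (generator c)"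
  shows "F = G"
proof
  have "F (basis m) = G (basis m)" for m
  proof (induction m)
    case empty
    then show ?case using F G by (simp add: alg_hom_def)
  next
    case (add c m)
    have "F (basis ({#c#} + m)) = G (basis ({#c#} + m))"
      unfolding basis_add using F G gen add by (simp add: alg_hom_def)
    then show ?case by simp
  qed
  moreover have "lin F" "lin G" using F G unfolding alg_hom_def by blast+
  ultimately show "F x = G x" for x using lin_eqI[of F G] by blast
qed

lemma alg_hom_mult_ext: "alg_hom (mult_ext f)"
  unfolding mult_ext_def by (rule alg_hom_linear_ext) auto

lemma mult_ext_generator: "mult_ext f (generator c) = f c"
  by (simp add: mult_ext_def)

text \<open>
  Pure tensors factor through the two embeddings \<open>x \<mapsto> x \<otimes> 1\<close> and \<open>y \<mapsto> 1 \<otimes> y\<close>. This reduces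
  the multiplicativity of the tensor product to commutativity.
\<close>

lemma tensor_eq_times:
  fixes x :: "'a::comm_monoid_add \<Rightarrow>\<^sub>0 'k::field" and y :: "'b::comm_monoid_add \<Rightarrow>\<^sub>0 'k"
  shows "x \<otimes>\<^sub>k y = linear_ext (\<lambda>a. basis (a, 0)) x * linear_ext (\<lambda>b. basis (0, b)) y"
    (is "_ = ?i x * ?j y")
proof (rule lin_eqI[of "\<lambda>x. x \<otimes>\<^sub>k y" "\<lambda>x. ?i x * ?j y"])
  show "basis a \<otimes>\<^sub>k y = ?i (basis a) * ?j y" for a
  proof (rule lin_eqI[of "\<lambda>y. basis a \<otimes>\<^sub>k y" "\<lambda>y. ?i (basis a) * ?j y"])
    show "basis a \<otimes>\<^sub>k basis b = ?i (basis a) * ?j (basis b)" for b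
      by (simp flip: basis_add)
  qed (rule lin_tensor_right lin_times_left[OF linear_linear_ext])+
qed (rule lin_tensor_left lin_times[OF linear_linear_ext])+

lemma tensor_times:
  fixes x x' :: "'a::comm_monoid_add \<Rightarrow>\<^sub>0 'k::field" and y y' :: "'b::comm_monoid_add \<Rightarrow>\<^sub>0 'k"
  shows "(x * x') \<otimes>\<^sub>k (y * y') = (x \<otimes>\<^sub>k y) * (x' \<otimes>\<^sub>k y')"
proof -
  have "alg_hom (linear_ext (\<lambda>a. basis (a, 0)) :: ('a \<Rightarrow>\<^sub>0 'k) \<Rightarrow> ('a \<times> 'b \<Rightarrow>\<^sub>0 'k))"
       "alg_hom (linear_ext (\<lambda>b. basis (0, b)) :: ('b \<Rightarrow>\<^sub>0 'k) \<Rightarrow> ('a \<times> 'b \<Rightarrow>\<^sub>0 'k))"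
    by (rule alg_hom_linear_ext; simp add: zero_prod_def mult_single one_eq_basis del: single_one)+
  then show ?thesis unfolding tensor_eq_times alg_hom_def by (simp add: ac_simps)
qed

lemma tensor_one: "1 \<otimes>\<^sub>k 1 = (1 :: ('a::comm_monoid_add \<times> 'b::comm_monoid_add) \<Rightarrow>\<^sub>0 'k::field)"
  by (simp add: one_eq_basis zero_prod_def del: single_one)

lemma alg_hom_tensor_map:
  assumes "alg_hom F" "alg_hom G"
  shows "alg_hom (tensor_map F G)"
  unfolding tensor_map_def
proof (rule alg_hom_linear_ext)
  show "(case 0 of (a, b) \<Rightarrow> F (basis a) \<otimes>\<^sub>k G (basis b)) = 1"
    using assms tensor_one by (simp add: alg_hom_def zero_prod_def)
  show "(case p + q of (a, b) \<Rightarrow> F (basis a) \<otimes>\<^sub>k G (basis b)) =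
      (case p of (a, b) \<Rightarrow> F (basis a) \<otimes>\<^sub>k G (basis b)) *
      (case q of (a, b) \<Rightarrow> F (basis a) \<otimes>\<^sub>k G (basis b))" for p q
    using assms by (cases p; cases q) (simp add: alg_hom_def basis_add tensor_times del: mult_single)
qed

lemma alg_hom_tensor_assoc: "alg_hom tensor_assoc"
  unfolding tensor_assoc_def
  by (rule alg_hom_linear_ext)
     (auto simp: zero_prod_def mult_single one_eq_basis split: prod.splits simp del: single_one)

lemma tensor_map_basis: "tensor_map F G (basis (a, b)) = F (basis a) \<otimes>\<^sub>k G (basis b)"
  by (simp add: tensor_map_def)

lemma lin_tensor_map: "lin (tensor_map F G)"
  unfolding tensor_map_def by (rule linear_linear_ext)

lemma lin_tensor_assoc: "lin tensor_assoc"
  unfolding tensor_assoc_def by (rule linear_linear_ext)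


section \<open>The counit\<close>

text \<open>
  The value of the counit on one couple.
\<close>

definition edgeless :: "couple \<Rightarrow> 'k::field" where
  "edgeless c = (case couple_rep c of (t, s) \<Rightarrow> if parcs s = {} then 1 else 0)"

lemma counit_superset:
  assumes "finite A" "Poly_Mapping.keys x \<subseteq> A"
  shows "counit x = (\<Sum>m \<in> A. Poly_Mapping.lookup x m * (\<Prod>c \<in># m. edgeless c))"
  unfolding counit_def edgeless_def
  by (rule sum.mono_neutral_left) (use assms in \<open>auto simp: in_keys_iff\<close>)

lemma counit_basis: "counit (basis m) = (\<Prod>c \<in># m. edgeless c :: 'k::field)"
  by (subst counit_superset[of "{m}"]) auto

lemma linear_counit: "Vector_Spaces.linear scale (*) (counit :: 'k::field D_tilde \<Rightarrow> 'k)"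
proof -
  interpret A: vector_space "scale :: 'k \<Rightarrow> 'k D_tilde \<Rightarrow> _" by (rule vector_space_scale)
  show ?thesis
  proof unfold_locales
    fix x y :: "'k D_tilde"
    let ?A = "Poly_Mapping.keys x \<union> Poly_Mapping.keys y"
    show "counit (x + y) = counit x + counit y"
      using keys_add[of x y]
      by (subst (1 2 3) counit_superset[where A = ?A])
         (auto simp: lookup_add distrib_right sum.distrib)
  next
    fix c and x :: "'k D_tilde"
    show "counit (scale c x) = c * counit x"
      by (subst (1 2) counit_superset[where A = "Poly_Mapping.keys x"])
         (auto simp: sum_distrib_left mult.assoc in_keys_iff)
  qed (auto simp: algebra_simps)
qed

lemma alg_hom_counit_tensor_id:
  "alg_hom (counit_tensor_id counit :: (couple multiset \<times> 'm::comm_monoid_add \<Rightarrow>\<^sub>0 'k::field) \<Rightarrow> _)"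
  unfolding counit_tensor_id_def
  by (rule alg_hom_linear_ext)
     (auto simp: zero_prod_def counit_basis scale_single mult_single one_eq_basis
       split: prod.splits simp del: single_one)

lemma alg_hom_id_tensor_counit:
  "alg_hom (id_tensor_counit counit :: ('m::comm_monoid_add \<times> couple multiset \<Rightarrow>\<^sub>0 'k::field) \<Rightarrow> _)"
  unfolding id_tensor_counit_def
  by (rule alg_hom_linear_ext)
     (auto simp: zero_prod_def counit_basis scale_single mult_single one_eq_basis
       split: prod.splits simp del: single_one)

lemma counit_tensor_id_basis:
  "counit_tensor_id counit (basis ({#a#}, b)) = scale (edgeless a) (basis b)"
  by (simp add: counit_tensor_id_def counit_basis)

lemma id_tensor_counit_basis:
  "id_tensor_counit counit (basis (a, {#b#})) = scale (edgeless b) (basis a)"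
  by (simp add: id_tensor_counit_def counit_basis)

section \<open>The coaction on generators\<close>

text \<open>
  The common formula of \<open>\<Gamma>\<close> and \<open>\<phi>\<close> on a generator. The map \<^term>\<open>g\<close> converts the second factor into the
  basis in question: it is the identity for \<open>\<Gamma>\<close> and the passage to cut couples for \<open>\<phi>\<close>.
\<close>

definition coaction_sum ::
    "(couple \<Rightarrow> 'm) \<Rightarrow> 'a pair_pre_digraph \<Rightarrow> 'a pair_pre_digraph \<Rightarrow>
     (couple multiset \<times> 'm multiset \<Rightarrow>\<^sub>0 'k::field)" where
  "coaction_sum g t s = (\<Sum>s' | covering_subforest s' s.
     basis ({#couple_of t s'#}, {#g (couple_of (contract t s') (contract s s'))#}))"

lemma Gamma_sum_eq: "Gamma_sum t s = coaction_sum (\<lambda>c. c) t s"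
  by (simp add: Gamma_sum_def coaction_sum_def)

lemma phi_sum_eq: "phi_sum t s = coaction_sum Abs_cut_couple t s"
  by (simp add: phi_sum_def coaction_sum_def cut_couple_of_def)

text \<open>
  The formula does not depend on the representative of the isomorphism class.
\<close>

lemma coaction_sum_iso:
  assumes iso: "couple_iso (t, s) (t', s')" and ok: "valid_couple t s"
  shows "coaction_sum g t' s' = coaction_sum g t s"
proof -
  obtain f where f: "inj_on f (pverts t)" and eq: "t' = map_graph f t" "s' = map_graph f s"
    using iso unfolding couple_iso_def by auto
  have "couple_of (map_graph f t) (map_graph f u) = couple_of t u"
      "couple_of (contract (map_graph f t) (map_graph f u)) (contract (map_graph f s) (map_graph f u)) =
       couple_of (contract t u) (contract s u)" if "covering_subforest u s" for u
    using couple_of_map_graph[OF valid_couple_contract(1)[OF ok that] f]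
      couple_of_contract_map_graph[OF ok that f] by simp_all
  then show ?thesis unfolding coaction_sum_def eq
    by (subst sum.reindex_bij_betw[OF bij_betw_map_graph_covering[OF ok f], symmetric])
       (rule sum.cong, simp_all)
qed

lemma edgeless_couple_of:
  assumes "valid_couple t s"
  shows "edgeless (couple_of t s) = (if parcs s = {} then 1 else 0)"
proof -
  obtain f where "couple_rep (couple_of t s) = (map_graph f t, map_graph f s)"
    using couple_iso_couple_rep[OF assms] unfolding couple_iso_def by auto
  then show ?thesis by (simp add: edgeless_def)
qed

text \<open>
  The chosen representative can be replaced by any other.
\<close>

lemma Gamma_generator:
  assumes "valid_couple t s"
  shows "Gamma (generator (couple_of t s)) = coaction_sum (\<lambda>c. c) t s"
proof -
  obtain t0 s0 where rep: "couple_rep (couple_of t s) = (t0, s0)" by (cases "couple_rep (couple_of t s)")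
  then have "couple_iso (t, s) (t0, s0)" using couple_iso_couple_rep[OF assms] by simp
  then show ?thesis
    using coaction_sum_iso assms by (simp add: Gamma_def mult_ext_generator rep Gamma_sum_eq)
qed

lemma phi_generator:
  assumes t: "rooted_tree t" and s: "up_closed s t"
  shows "phi (generator (cut_couple_of t s)) = coaction_sum Abs_cut_couple t s"
proof -
  have ok: "valid_couple t s" using t up_closed_sub_graph[OF s] by (simp add: valid_couple_def)
  obtain t0 s0 where rep: "couple_rep (couple_of t s) = (t0, s0)" by (cases "couple_rep (couple_of t s)")
  then have "couple_iso (t, s) (t0, s0)" using couple_iso_couple_rep[OF ok] by simp
  then show ?thesis
    using coaction_sum_iso ok
    by (simp add: phi_def mult_ext_generator cut_couple_rep_def Rep_cut_couple_of[OF t s] rep phi_sum_eq)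
qed

text \<open>
  The third isomorphism theorem for contractions.
\<close>

lemma couple_of_iterated_contract:
  assumes ok: "valid_couple t s" and u: "covering_subforest u s" and v: "covering_subforest v u"
  shows "couple_of (contract (contract t v) (contract u v)) (contract (contract s v) (contract u v)) =
    couple_of (contract t u) (contract s u)"
proof -
  note ok_u = valid_couple_contract(1)[OF ok u]
  note ok_v = valid_couple_contract(1)[OF ok_u v]
  have sub: "parcs v \<subseteq> parcs u" using v covering_subforest_iff[OF valid_couple_forest(2)[OF ok_u]] by blast
  let ?b = "block (contract u v) \<circ> block v"
  have "couple_iso (quot (block u) t, quot (block u) s) (quot ?b t, quot ?b s)"
  proof (rule couple_iso_quot[OF _ ok])
    show "block u x = block u y \<longleftrightarrow> ?b x = ?b y" for x y
      using block_contract_iff[OF valid_couple_wf(2)[OF ok_v] valid_couple_wf(2)[OF ok_u] sub] by simp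
  qed
  then have "couple_iso (contract t u, contract s u)
      (contract (contract t v) (contract u v), contract (contract s v) (contract u v))"
    by (simp only: contract_eq_quot quot_quot)
  then show ?thesis by (rule couple_of_eqI[symmetric, OF _ valid_couple_contract(2)[OF ok u]])
qed

lemma covering_trans:
  assumes s: "rooted_forest s" and u: "covering_subforest u s" and v: "covering_subforest v u"
  shows "covering_subforest v s"
proof -
  have "rooted_forest u" using sub_graph_forest[OF covering_imp_sub_graph[OF s u] s] .
  then show ?thesis using u v s covering_subforest_iff by blast
qed

text \<open>
  Both sides run over the chains \<open>v \<subseteq> u \<subseteq> s\<close> of covering subforests. After exchanging the two
  summations, the inner sum over \<open>u\<close> is reindexed by its contraction along \<open>v\<close>. The value of
  \<^term>\<open>\<rho>\<close> is needed only on the generators that occur in the second tensor factor, which matters for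
  cut couples because not every pair of graphs gives one.
\<close>

lemma coassoc_on_generator:
  fixes \<rho> :: "('m, 'k::field) sym \<Rightarrow> (couple multiset \<times> 'm multiset \<Rightarrow>\<^sub>0 'k)"
  assumes ok: "valid_couple t s"
    and \<rho>: "\<rho> x = coaction_sum g t s"
    and \<rho>': "\<And>u. covering_subforest u s \<Longrightarrow>
      \<rho> (generator (g (couple_of (contract t u) (contract s u)))) =
      coaction_sum g (contract t u) (contract s u)"
  shows "tensor_assoc (tensor_map Gamma id (\<rho> x)) = tensor_map id \<rho> (\<rho> x)"
proof -
  let ?C = "\<lambda>s. {u. covering_subforest u s}"
  define term3 :: "_ \<Rightarrow> _ \<Rightarrow> couple multiset \<times> couple multiset \<times> 'm multiset \<Rightarrow>\<^sub>0 'k" where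
    "term3 u v = basis ({#couple_of t v#}, {#couple_of (contract t v) (contract u v)#},
       {#g (couple_of (contract t u) (contract s u))#})" for u v
  note forest = valid_couple_forest(2)[OF ok]
  have "tensor_assoc (tensor_map Gamma id (\<rho> x)) = (\<Sum>u \<in> ?C s. \<Sum>v \<in> ?C u. term3 u v)"
  proof -
    have "tensor_assoc (Gamma (generator (couple_of t u)) \<otimes>\<^sub>k basis m) =
        (\<Sum>v \<in> ?C u. basis ({#couple_of t v#}, {#couple_of (contract t v) (contract u v)#}, m))"
      if "covering_subforest u s" for u and m :: "'m multiset"
      unfolding Gamma_generator[OF valid_couple_contract(1)[OF ok that]] coaction_sum_def
      by (simp add: tensor_sum_left lin_sum[OF lin_tensor_assoc]) (simp add: tensor_assoc_def)
    then show ?thesis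
      unfolding \<rho> coaction_sum_def[of g t s] lin_sum[OF lin_tensor_map] lin_sum[OF lin_tensor_assoc]
      by (intro sum.cong) (simp_all add: tensor_map_basis term3_def)
  qed
  also have "\<dots> = (\<Sum>u \<in> ?C s. \<Sum>v \<in> {v \<in> ?C s. covering_subforest v u}. term3 u v)"
    using covering_trans[OF forest] by (intro sum.cong) auto
  also have "\<dots> = (\<Sum>v \<in> ?C s. \<Sum>u \<in> {u \<in> ?C s. covering_subforest v u}. term3 u v)"
    using finite_covering_subforests[OF forest] by (intro sum.swap_restrict)
  also have "\<dots> = (\<Sum>v \<in> ?C s. \<Sum>w \<in> ?C (contract s v). basis ({#couple_of t v#},
      {#couple_of (contract t v) w#},
      {#g (couple_of (contract (contract t v) w) (contract (contract s v) w))#}))"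
  proof (rule sum.cong[OF refl])
    fix v assume "v \<in> ?C s"
    then have v: "covering_subforest v s" by simp
    have bij: "bij_betw (\<lambda>u. contract u v) {u \<in> ?C s. covering_subforest v u} (?C (contract s v))"
      using bij_betw_contract_covering[OF forest valid_couple_forest(2)[OF valid_couple_contract(2)[OF ok v]] v]
      by simp
    show "(\<Sum>u \<in> {u \<in> ?C s. covering_subforest v u}. term3 u v) =
        (\<Sum>w \<in> ?C (contract s v). basis ({#couple_of t v#}, {#couple_of (contract t v) w#},
          {#g (couple_of (contract (contract t v) w) (contract (contract s v) w))#}))"
      unfolding sum.reindex_bij_betw[OF bij, symmetric]
      by (rule sum.cong[OF refl]) (simp add: term3_def couple_of_iterated_contract[OF ok])
  qed
  also have "\<dots> = tensor_map id \<rho> (\<rho> x)"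
    unfolding \<rho> coaction_sum_def[of g t s] lin_sum[OF lin_tensor_map]
    by (intro sum.cong) (simp_all add: tensor_map_basis \<rho>' coaction_sum_def tensor_sum_right)
  finally show ?thesis .
qed

lemma scale_one_zero: "scale 1 x = x" "scale 0 x = 0"
  by (auto intro: poly_mapping_eqI)

text \<open>
  The blocks of an arcless subforest are singletons, so contracting it only relabels.
\<close>

lemma couple_of_contract_discrete:
  assumes ok: "valid_couple t s"
  defines "d \<equiv> \<lparr>pverts = pverts s, parcs = {}\<rparr>"
  shows "couple_of (contract t d) (contract s d) = couple_of t s"
proof -
  have "block d x = block d y \<longleftrightarrow> x = y" for x y
    by (subst block_eq_iff) (auto simp: d_def linked_def)
  then have inj: "inj_on (block d) (pverts t)" by (auto intro: inj_onI)
  have "acyclic (parcs t)" "acyclic (parcs s)"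
    using valid_couple_forest[OF ok] unfolding rooted_forest_def by auto
  then have "contract t d = map_graph (block d) t" "contract s d = map_graph (block d) s"
    unfolding contract_eq_quot using quot_inj_eq_map_graph[OF inj] valid_couple_wf[OF ok] by auto
  then show ?thesis using couple_of_map_graph[OF ok inj] by simp
qed

lemma lin_counit_tensor_id: "lin (counit_tensor_id \<epsilon>)"
  unfolding counit_tensor_id_def by (rule linear_linear_ext)

lemma lin_id_tensor_counit: "lin (id_tensor_counit \<epsilon>)"
  unfolding id_tensor_counit_def by (rule linear_linear_ext)

text \<open>
  Only the arcless covering subforest has a nonzero counit.
\<close>

lemma counit_on_generator:
  assumes ok: "valid_couple t s"
  shows "counit_tensor_id counit (coaction_sum g t s) =
    (generator (g (couple_of t s)) :: ('m, 'k::field) sym)"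
proof -
  let ?d = "\<lparr>pverts = pverts s, parcs = {}\<rparr>"
  let ?C = "{u. covering_subforest u s}"
  let ?f = "\<lambda>u. generator (g (couple_of (contract t u) (contract s u))) :: ('m, 'k) sym"
  note forest = valid_couple_forest(2)[OF ok]
  have "counit_tensor_id counit (coaction_sum g t s) =
      (\<Sum>u \<in> ?C. scale (edgeless (couple_of t u)) (?f u))"
    unfolding coaction_sum_def lin_sum[OF lin_counit_tensor_id]
    by (simp add: counit_tensor_id_basis)
  also have "\<dots> = (\<Sum>u \<in> ?C. if u = ?d then ?f ?d else 0)"
  proof (rule sum.cong[OF refl])
    fix u assume "u \<in> ?C"
    then have u: "covering_subforest u s" by simp
    then have "parcs u = {} \<longleftrightarrow> u = ?d" using covering_subforest_iff[OF forest] by (auto intro: graph_eqI)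
    then show "scale (edgeless (couple_of t u)) (?f u) = (if u = ?d then ?f ?d else 0)"
      by (auto simp: edgeless_couple_of[OF valid_couple_contract(1)[OF ok u]] scale_one_zero)
  qed
  also have "\<dots> = ?f ?d"
    using finite_covering_subforests[OF forest] by (simp add: covering_subforest_iff[OF forest])
  also have "\<dots> = generator (g (couple_of t s))" by (simp only: couple_of_contract_discrete[OF ok])
  finally show ?thesis .
qed

text \<open>
  The contraction of \<^term>\<open>s\<close> along \<open>u\<close> has no arc exactly when every arc of \<^term>\<open>s\<close> lies inside a block,
  that is, belongs to \<open>u\<close>.
\<close>

lemma right_counit_on_generator:
  assumes ok: "valid_couple t s"
  shows "id_tensor_counit counit (coaction_sum (\<lambda>c. c) t s) =
    (generator (couple_of t s) :: 'k::field D_tilde)"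
proof -
  let ?C = "{u. covering_subforest u s}"
  note forest = valid_couple_forest(2)[OF ok]
  have "id_tensor_counit counit (coaction_sum (\<lambda>c. c) t s :: 'k D_tilde_tensor_D_tilde) =
      (\<Sum>u \<in> ?C. scale (edgeless (couple_of (contract t u) (contract s u))) (generator (couple_of t u)))"
    unfolding coaction_sum_def lin_sum[OF lin_id_tensor_counit]
    by (simp add: id_tensor_counit_basis)
  also have "\<dots> = (\<Sum>u \<in> ?C. if u = s then generator (couple_of t s) else 0)"
  proof (rule sum.cong[OF refl])
    fix u assume "u \<in> ?C"
    then have u: "covering_subforest u s" by simp
    then have u': "pverts u = pverts s" "parcs u \<subseteq> parcs s" using covering_subforest_iff[OF forest] by auto
    have "parcs (contract s u) = {} \<longleftrightarrow> (\<forall>(x, y) \<in> parcs s. block u x = block u y)"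
      unfolding contract_eq_quot parcs_quot by blast
    also have "\<dots> \<longleftrightarrow> parcs s \<subseteq> parcs u"
      using block_eq_arc_iff[OF forest covering_imp_sub_graph[OF forest u]] by auto
    also have "\<dots> \<longleftrightarrow> u = s" using u' by (auto intro: graph_eqI)
    finally show "scale (edgeless (couple_of (contract t u) (contract s u))) (generator (couple_of t u)) =
        (if u = s then generator (couple_of t s) else 0)"
      by (auto simp: edgeless_couple_of[OF valid_couple_contract(2)[OF ok u]] scale_one_zero)
  qed
  also have "\<dots> = generator (couple_of t s)"
    using finite_covering_subforests[OF forest]
    by (simp add: covering_subforest_iff[OF forest])
  finally show ?thesis .
qed


section \<open>Extension to the symmetric algebras\<close>

lemma alg_hom_Gamma: "alg_hom Gamma"
  unfolding Gamma_def by (rule alg_hom_mult_ext)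

lemma alg_hom_phi: "alg_hom phi"
  unfolding phi_def by (rule alg_hom_mult_ext)

lemma alg_hom_lin: "alg_hom F \<Longrightarrow> lin F"
  by (simp add: alg_hom_def)

lemma coalgebra_Gamma: "coalgebra Gamma counit"
proof -
  have "tensor_assoc \<circ> tensor_map Gamma id \<circ> Gamma = tensor_map id Gamma \<circ> Gamma"
  proof (rule alg_hom_eqI)
    fix c
    obtain t s :: "nat pair_pre_digraph" where ok: "valid_couple t s" and c: "c = couple_of t s"
      by (rule couple_cases)
    have "tensor_assoc (tensor_map Gamma id (Gamma (generator c))) = tensor_map id Gamma (Gamma (generator c))"
      by (rule coassoc_on_generator[OF ok, where g = "\<lambda>c. c"])
         (simp_all add: c Gamma_generator[OF ok] Gamma_generator[OF valid_couple_contract(2)[OF ok]])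
    then show "(tensor_assoc \<circ> tensor_map Gamma id \<circ> Gamma) (generator c) =
        (tensor_map id Gamma \<circ> Gamma) (generator c)" by simp
  qed (intro alg_hom_comp alg_hom_tensor_map alg_hom_tensor_assoc alg_hom_Gamma alg_hom_id)+
  moreover have "counit_tensor_id counit \<circ> Gamma = id"
  proof (rule alg_hom_eqI)
    fix c
    obtain t s :: "nat pair_pre_digraph" where "valid_couple t s" "c = couple_of t s"
      by (rule couple_cases)
    then show "(counit_tensor_id counit \<circ> Gamma) (generator c) = id (generator c)"
      by (simp add: Gamma_generator counit_on_generator)
  qed (intro alg_hom_comp alg_hom_counit_tensor_id alg_hom_Gamma alg_hom_id)+
  moreover have "id_tensor_counit counit \<circ> Gamma = id"
  proof (rule alg_hom_eqI)
    fix c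
    obtain t s :: "nat pair_pre_digraph" where "valid_couple t s" "c = couple_of t s"
      by (rule couple_cases)
    then show "(id_tensor_counit counit \<circ> Gamma) (generator c) = id (generator c)"
      by (simp add: Gamma_generator right_counit_on_generator)
  qed (intro alg_hom_comp alg_hom_id_tensor_counit alg_hom_Gamma alg_hom_id)+
  ultimately show ?thesis
    unfolding coalgebra_def using alg_hom_lin[OF alg_hom_Gamma] linear_counit by blast
qed

lemma left_coaction_phi: "left_coaction Gamma counit phi"
proof -
  have "tensor_assoc \<circ> tensor_map Gamma id \<circ> phi = tensor_map id phi \<circ> phi"
  proof (rule alg_hom_eqI)
    fix c
    obtain t s :: "nat pair_pre_digraph" where t: "rooted_tree t" and s: "up_closed s t"
        and c: "c = cut_couple_of t s"
      by (rule cut_couple_cases)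
    have ok: "valid_couple t s" using t up_closed_sub_graph[OF s] by (simp add: valid_couple_def)
    have "phi (generator (Abs_cut_couple (couple_of (contract t u) (contract s u)))) =
        coaction_sum Abs_cut_couple (contract t u) (contract s u)" if u: "covering_subforest u s" for u
    proof -
      have "up_closed (contract s u) (contract t u)"
        using up_closed_contract[OF s _ valid_couple_wf(2)[OF valid_couple_contract(1)[OF ok u]]]
          u[unfolded covering_subforest_def] by blast
      moreover have "rooted_tree (contract t u)"
        using valid_couple_contract(2)[OF ok u] unfolding valid_couple_def by blast
      ultimately show ?thesis by (simp only: phi_generator flip: cut_couple_of_def)
    qed
    from coassoc_on_generator[OF ok phi_generator[OF t s] this]
    show "(tensor_assoc \<circ> tensor_map Gamma id \<circ> phi) (generator c) =
        (tensor_map id phi \<circ> phi) (generator c)" by (simp add: c)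
  qed (intro alg_hom_comp alg_hom_tensor_map alg_hom_tensor_assoc alg_hom_Gamma alg_hom_phi alg_hom_id)+
  moreover have "counit_tensor_id counit \<circ> phi = id"
  proof (rule alg_hom_eqI)
    fix c
    obtain t s :: "nat pair_pre_digraph" where t: "rooted_tree t" and s: "up_closed s t"
        and c: "c = cut_couple_of t s"
      by (rule cut_couple_cases)
    have ok: "valid_couple t s" using t up_closed_sub_graph[OF s] by (simp add: valid_couple_def)
    show "(counit_tensor_id counit \<circ> phi) (generator c) = id (generator c)"
      unfolding o_apply id_apply c phi_generator[OF t s] counit_on_generator[OF ok]
      by (simp only: cut_couple_of_def)
  qed (intro alg_hom_comp alg_hom_counit_tensor_id alg_hom_phi alg_hom_id)+
  ultimately show ?thesis
    unfolding left_coaction_def using alg_hom_lin[OF alg_hom_phi] by blast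
qed

theorem theorem4:
  shows
    "(\<forall>(t :: 'a pair_pre_digraph) s. rooted_tree t \<and> subforest s t \<longrightarrow>
        (\<forall>s'. covering_subforest s' s \<longrightarrow>
           subforest s' t \<and> rooted_tree (contract t s') \<and>
           subforest (contract s s') (contract t s')) \<and>
        Gamma (generator (couple_of t s) :: 'k::field D_tilde) = Gamma_sum t s \<and>
        counit (generator (couple_of t s) :: 'k D_tilde) = (if parcs s = {} then 1 else 0)) \<and>
     (\<forall>(t :: 'a pair_pre_digraph) c. rooted_tree t \<and> admissible_cut t c \<longrightarrow>
        subforest (pruning t c) t \<and>
        (\<forall>s'. covering_subforest s' (pruning t c) \<longrightarrow>
           (\<exists>c'. admissible_cut (contract t s') c' \<and>
                 contract (pruning t c) s' = pruning (contract t s') c')) \<and>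
        phi (generator (cut_couple_of t (pruning t c)) :: 'k D) = phi_sum t (pruning t c)) \<and>
     coalgebra (Gamma :: 'k D_tilde \<Rightarrow> 'k D_tilde_tensor_D_tilde) counit \<and>
     left_coaction Gamma counit (phi :: 'k D \<Rightarrow> 'k D_tilde_tensor_D)"
proof (intro conjI allI impI; (elim conjE)?)
  fix t s :: "'a pair_pre_digraph"
  assume "rooted_tree t" "subforest s t"
  then have ok: "valid_couple t s" by (simp add: valid_couple_iff)
  show "Gamma (generator (couple_of t s) :: 'k D_tilde) = Gamma_sum t s"
    by (simp only: Gamma_generator[OF ok] Gamma_sum_eq)
  show "counit (generator (couple_of t s) :: 'k D_tilde) = (if parcs s = {} then 1 else 0)"
    by (simp add: counit_basis edgeless_couple_of[OF ok])
  fix s' assume s': "covering_subforest s' s"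
  show "subforest s' t" "rooted_tree (contract t s')" "subforest (contract s s') (contract t s')"
    using valid_couple_contract[OF ok s'] by (simp_all add: valid_couple_iff)
next
  fix t :: "'a pair_pre_digraph" and c
  assume t: "rooted_tree t" and c: "admissible_cut t c"
  have up: "up_closed (pruning t c) t" using pruning_iff_up_closed[OF t] c by blast
  then have ok: "valid_couple t (pruning t c)" using t up_closed_sub_graph by (simp add: valid_couple_def)
  then show "subforest (pruning t c) t" by (simp add: valid_couple_iff)
  show "phi (generator (cut_couple_of t (pruning t c)) :: 'k D) = phi_sum t (pruning t c)"
    by (simp only: phi_generator[OF t up] phi_sum_eq)
  fix s' assume s': "covering_subforest s' (pruning t c)"
  have "up_closed (contract (pruning t c) s') (contract t s')"
    using up_closed_contract[OF up _ valid_couple_wf(2)[OF valid_couple_contract(1)[OF ok s']]]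
      s'[unfolded covering_subforest_def] by blast
  moreover have "rooted_tree (contract t s')"
    using valid_couple_contract(2)[OF ok s'] unfolding valid_couple_def by blast
  ultimately show "\<exists>c'. admissible_cut (contract t s') c' \<and>
      contract (pruning t c) s' = pruning (contract t s') c'"
    using pruning_iff_up_closed by blast
qed (rule coalgebra_Gamma left_coaction_phi)+

end
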